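(* Let $P$ be a Markov kernel on the metric space $(E,d)$ with Borel $\sigma$-field $\mathcal{E}:=\mathcal{B}(E)$. Let $\rho:E\times E\to[0,\infty)$ be a function such that either $\rho=d$, or $E$ is Polish and $\rho$ is lower semicontinuous and positive definite. Assume that there exists a set $M\in\mathcal{E}$ such that $\mu(M)>0$ for every invariant probability measure $\mu$ of $P$, and such that for every $x,y\in M$ there exists $\alpha_{x,y}>0$ such that for every $\varepsilon>0$ there exists some $\xi^{\varepsilon}_{x,y}\in\hat{\mathcal{C}}(\mathbb{P}_x,\mathbb{P}_y)$ with $$\xi^{\varepsilon}_{x,y}\Big(\Big\{(\xi,\eta)\in E^{\mathbb{N}_0}\times E^{\mathbb{N}_0}:\ \limsup_{n\to\infty}\frac1n\sum_{i=0}^{n-1}\mathbf{1}_{[0,\varepsilon]}\big(\rho(\xi_i,\eta_i)\big)\ge\alpha_{x,y}\Big\}\Big)>0 .$$ Then there exists at most one invariant probability measure of $P$.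
   Context: A Markov kernel $P$ on a measurable space $(E,\mathcal{E})$ is a map $P:E\times\mathcal{E}\to[0,1]$ such that $P(x,\cdot)$ is a probability measure for each $x$ and $P(\cdot,A)$ is measurable for each $A\in\mathcal{E}$. An invariant probability measure of $P$ is a probability measure $\pi$ on $(E,\mathcal{E})$ with $\pi P=\pi$, where $\pi P(A)=\int P(x,A)\,\mathrm{d}\pi(x)$. For $x\in E$, $\mathbb{P}_x$ denotes the law on $(E^{\mathbb{N}_0},\mathcal{E}^{\mathbb{N}_0})$ (product $\sigma$-field) of the Markov chain with kernel $P$ and initial condition $x$. $\hat{\mathcal{C}}(\mathbb{P}_x,\mathbb{P}_y)$ is the set of generalized couplings of $\mathbb{P}_x$ and $\mathbb{P}_y$: the set of all probability measures $\xi$ on $E^{\mathbb{N}_0}\times E^{\mathbb{N}_0}$ (with the product $\sigma$-field $\mathcal{E}^{\mathbb{N}_0}\otimes\mathcal{E}^{\mathbb{N}_0}$) such that $\pi_1(\xi)\ll\mathbb{P}_x$ and $\pi_2(\xi)\ll\mathbb{P}_y$, where $\pi_i(\xi)$ is the image of $\xi$ under the projection on the $i$-th coordinate ($i=1,2$) and $\ll$ denotes absolute continuity. The metric space $E$ is not assumed separable. A metric space is called Polish here if its topology is separable and completely metrizable (the metric $d$ itself need not be complete). A function $\rho:E\times E\to[0,\infty)$ is positive definite if $\rho(x,y)=0$ if and only if $x=y$ (neither symmetry nor a triangle inequality is required). Convention: if $E$ is not separable, $d$ need not be $\mathcal{B}(E)\otimes\mathcal{B}(E)$-measurable. Whenever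 a probability measure $\xi$ is evaluated at a set $A$ that is not measurable, $\xi(A)$ is interpreted as $\xi^*(A)$, where $\xi^*$ is the outer measure associated to $\xi$. *)

theory Defs
  imports "HOL-Probability.Probability"
begin

definition markov_kernel :: "'a measure \<Rightarrow> ('a \<Rightarrow> 'a measure) \<Rightarrow> bool" where
  "markov_kernel M K \<longleftrightarrow> K \<in> M \<rightarrow>\<^sub>M prob_algebra M"

lemma markov_kernel_iff:
  "markov_kernel M K \<longleftrightarrow>
     (\<forall>x\<in>space M. prob_space (K x) \<and> sets (K x) = sets M) \<and>
     (\<forall>A\<in>sets M. (\<lambda>x. measure (K x) A) \<in> borel_measurable M)"
proof
  assume "markov_kernel M K"
  then have K[measurable]: "K \<in> M \<rightarrow>\<^sub>M prob_algebra M"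
    by (simp add: markov_kernel_def)
  show "(\<forall>x\<in>space M. prob_space (K x) \<and> sets (K x) = sets M) \<and>
     (\<forall>A\<in>sets M. (\<lambda>x. measure (K x) A) \<in> borel_measurable M)"
    using measurable_space[OF K] by (auto simp: space_prob_algebra)
next
  assume *: "(\<forall>x\<in>space M. prob_space (K x) \<and> sets (K x) = sets M) \<and>
     (\<forall>A\<in>sets M. (\<lambda>x. measure (K x) A) \<in> borel_measurable M)"
  have "(\<lambda>x. emeasure (K x) A) \<in> borel_measurable M" if A: "A \<in> sets M" for A
  proof -
    have "(\<lambda>x. ennreal (measure (K x) A)) \<in> borel_measurable M"
      using * A by auto
    moreover have "emeasure (K x) A = ennreal (measure (K x) A)" if "x \<in> space M" for x
      using * that
      by (meson finite_measure.emeasure_eq_measure prob_space.finite_measure)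
    ultimately show ?thesis
      by (simp cong: measurable_cong)
  qed
  then show "markov_kernel M K"
    unfolding markov_kernel_def
    using * by (intro measurable_prob_algebraI measurable_subprob_algebra)
      (auto intro: prob_space_imp_subprob_space)
qed

text \<open>For a probability measure \<open>\<mu>\<close> and a kernel \<open>K\<close>, the measure \<open>\<mu>K\<close> is the monadic
  bind \<open>\<mu> \<bind> K\<close>.\<close>

definition invariant_prob :: "'a measure \<Rightarrow> ('a \<Rightarrow> 'a measure) \<Rightarrow> 'a measure \<Rightarrow> bool" where
  "invariant_prob M K \<mu> \<longleftrightarrow> prob_space \<mu> \<and> sets \<mu> = sets M \<and> \<mu> \<bind> K = \<mu>"

lemma invariant_prob_iff:
  assumes "markov_kernel M K"
  shows "invariant_prob M K \<mu> \<longleftrightarrow> prob_space \<mu> \<and> sets \<mu> = sets M \<and>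
           (\<forall>A\<in>sets M. (\<integral>\<^sup>+x. emeasure (K x) A \<partial>\<mu>) = emeasure \<mu> A)"
proof (cases "prob_space \<mu> \<and> sets \<mu> = sets M")
  case True
  then have s: "sets \<mu> = sets M" and ne: "space \<mu> \<noteq> {}"
    by (auto dest: prob_space.not_empty)
  have "K \<in> \<mu> \<rightarrow>\<^sub>M subprob_algebra M"
    using assms measurable_prob_algebraD[of K M M]
    by (simp add: markov_kernel_def measurable_cong_sets[OF s refl])
  then have "sets (\<mu> \<bind> K) = sets M"
    and "\<And>A. A \<in> sets M \<Longrightarrow> emeasure (\<mu> \<bind> K) A = (\<integral>\<^sup>+x. emeasure (K x) A \<partial>\<mu>)"
    using ne sets_kernel[of K \<mu> M] by (auto intro!: sets_bind emeasure_bind)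
  then have "\<mu> \<bind> K = \<mu> \<longleftrightarrow> (\<forall>A\<in>sets M. (\<integral>\<^sup>+x. emeasure (K x) A \<partial>\<mu>) = emeasure \<mu> A)"
    using s by (metis measure_eqI)
  with True show ?thesis
    by (simp add: invariant_prob_def)
qed (auto simp: invariant_prob_def)

text \<open>The law on the path space \<open>Pi\<^sub>M UNIV (\<lambda>_. M)\<close> of the Markov chain with kernel \<open>K\<close> started at
  \<open>x\<close> is obtained from the Ionescu-Tulcea theorem: coordinate \<open>0\<close> is \<open>x\<close>, and given the
  coordinates \<open>0, \<dots>, n\<close> of a path \<open>\<omega>\<close>, coordinate \<open>n + 1\<close> has law \<open>K (\<omega> n)\<close>.\<close>

definition chain_step ::
    "'a measure \<Rightarrow> ('a \<Rightarrow> 'a measure) \<Rightarrow> 'a \<Rightarrow> nat \<Rightarrow> (nat \<Rightarrow> 'a) \<Rightarrow> 'a measure" where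
  "chain_step M K x n \<omega> = (case n of 0 \<Rightarrow> return M x | Suc m \<Rightarrow> K (\<omega> m))"

definition chain_law :: "'a measure \<Rightarrow> ('a \<Rightarrow> 'a measure) \<Rightarrow> 'a \<Rightarrow> (nat \<Rightarrow> 'a) measure" where
  "chain_law M K x =
     projective_family.lim UNIV (Ionescu_Tulcea.CI (chain_step M K x) (\<lambda>_. M)) (\<lambda>_. M)"

lemma Ionescu_Tulcea_chain_step:
  assumes "markov_kernel M K" and x: "x \<in> space M"
  shows "Ionescu_Tulcea (chain_step M K x) (\<lambda>_. M)"
proof -
  have K: "K \<in> M \<rightarrow>\<^sub>M prob_algebra M"
    using assms by (simp add: markov_kernel_def)
  have *: "chain_step M K x i \<in> Pi\<^sub>M {0..<i} (\<lambda>_. M) \<rightarrow>\<^sub>M prob_algebra M" for i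
  proof (cases i)
    case 0
    then show ?thesis
      using x by (simp add: chain_step_def[abs_def] space_prob_algebra prob_space_return)
  next
    case (Suc m)
    have "(\<lambda>\<omega>. \<omega> m) \<in> Pi\<^sub>M {0..<Suc m} (\<lambda>_. M) \<rightarrow>\<^sub>M M"
      by (rule measurable_component_singleton) simp
    from measurable_compose[OF this K] show ?thesis
      by (simp add: Suc chain_step_def[abs_def])
  qed
  then show ?thesis
    unfolding Ionescu_Tulcea_def
    using measurable_prob_algebraD[OF *] measurable_space[OF *]
    by (simp add: space_prob_algebra)
qed

lemma
  assumes "markov_kernel M K" and "x \<in> space M"
  shows sets_chain_law: "sets (chain_law M K x) = sets (Pi\<^sub>M UNIV (\<lambda>_. M))"
    and prob_space_chain_law: "prob_space (chain_law M K x)"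
    and chain_law_initial: "distr (chain_law M K x) M (\<lambda>\<omega>. \<omega> 0) = return M x"
    and chain_law_step:
      "distr (chain_law M K x) (Pi\<^sub>M {0..<Suc (Suc n)} (\<lambda>_. M)) (\<lambda>\<omega>. restrict \<omega> {0..<Suc (Suc n)}) =
         distr (chain_law M K x) (Pi\<^sub>M {0..<Suc n} (\<lambda>_. M)) (\<lambda>\<omega>. restrict \<omega> {0..<Suc n}) \<bind>
           (\<lambda>\<omega>. distr (K (\<omega> n)) (Pi\<^sub>M {0..<Suc (Suc n)} (\<lambda>_. M)) (fun_upd \<omega> (Suc n)))"
proof -
  interpret IT: Ionescu_Tulcea "chain_step M K x" "\<lambda>_. M"
    using assms by (rule Ionescu_Tulcea_chain_step)
  have law: "chain_law M K x = IT.PF.lim"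
    by (simp add: chain_law_def)
  show sets: "sets (chain_law M K x) = sets (Pi\<^sub>M UNIV (\<lambda>_. M))"
    by (simp add: law)
  have up_to: "IT.up_to {0..<m} = m" for m
    using IT.up_to[of "{0..<m}"] by (intro antisym) (auto simp: IT.up_to_iff_Ico)
  have restr: "distr (chain_law M K x) (Pi\<^sub>M {0..<m} (\<lambda>_. M)) (\<lambda>\<omega>. restrict \<omega> {0..<m}) =
      IT.C 0 m (\<lambda>_. undefined)" for m
  proof -
    have "IT.CI {0..<m} = IT.C 0 m (\<lambda>_. undefined)"
      using IT.distr_C[of m m "\<lambda>_. undefined" 0] by (simp add: IT.CI_def up_to)
    then show ?thesis
      by (simp add: law IT.distr_lim)
  qed
  have r: "(\<lambda>\<omega>. restrict \<omega> {0..<m}) \<in> chain_law M K x \<rightarrow>\<^sub>M Pi\<^sub>M {0..<m} (\<lambda>_. M)" for m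
    unfolding measurable_cong_sets[OF sets refl] by (rule measurable_restrict_subset) simp
  have "prob_space (IT.C 0 0 (\<lambda>_. undefined))"
    by (rule IT.prob_space_C) simp
  then show "prob_space (chain_law M K x)"
    by (subst (asm) restr[symmetric]) (rule prob_space_distrD[OF r])
  have "distr (chain_law M K x) M (\<lambda>\<omega>. \<omega> 0) =
      distr (distr (chain_law M K x) (Pi\<^sub>M {0..<Suc 0} (\<lambda>_. M)) (\<lambda>\<omega>. restrict \<omega> {0..<Suc 0})) M (\<lambda>\<omega>. \<omega> 0)"
    by (subst distr_distr[OF _ r]) (auto simp: comp_def)
  also have "\<dots> = distr (IT.eP 0 (\<lambda>_. undefined)) M (\<lambda>\<omega>. \<omega> 0)"
    unfolding restr using bind_return[OF IT.measurable_eP[of 0], of "\<lambda>_. undefined"]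
    by simp
  also have "\<dots> = return M x"
    unfolding IT.eP_def chain_step_def using \<open>x \<in> space M\<close>
    apply (subst distr_distr)
      apply (auto intro!: measurable_fun_upd[where J="{}"] simp: comp_def)
    apply (simp add: distr_id2)
    done
  finally show "distr (chain_law M K x) M (\<lambda>\<omega>. \<omega> 0) = return M x" .
  show "distr (chain_law M K x) (Pi\<^sub>M {0..<Suc (Suc n)} (\<lambda>_. M)) (\<lambda>\<omega>. restrict \<omega> {0..<Suc (Suc n)}) =
         distr (chain_law M K x) (Pi\<^sub>M {0..<Suc n} (\<lambda>_. M)) (\<lambda>\<omega>. restrict \<omega> {0..<Suc n}) \<bind>
           (\<lambda>\<omega>. distr (K (\<omega> n)) (Pi\<^sub>M {0..<Suc (Suc n)} (\<lambda>_. M)) (fun_upd \<omega> (Suc n)))"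
    unfolding restr by (subst IT.C.simps(2)) (simp add: IT.eP_def[abs_def] chain_step_def)
qed

text \<open>\<open>absolutely_continuous \<mu> \<nu>\<close> says that \<open>\<nu>\<close> is absolutely continuous with respect to
  \<open>\<mu>\<close>: the marginals of \<open>\<xi>\<close> are the second arguments below.\<close>

definition generalized_couplings :: "'a measure \<Rightarrow> 'b measure \<Rightarrow> ('a \<times> 'b) measure set" where
  "generalized_couplings \<mu> \<nu> =
     {\<xi>. prob_space \<xi> \<and> sets \<xi> = sets (\<mu> \<Otimes>\<^sub>M \<nu>) \<and>
         absolutely_continuous \<mu> (distr \<xi> \<mu> fst) \<and> absolutely_continuous \<nu> (distr \<xi> \<nu> snd)}"

text \<open>The library's type class of Polish spaces requires the given metric to be complete; the
  following notion is purely topological.\<close>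

definition polish_topology :: "'a topology \<Rightarrow> bool" where
  "polish_topology X \<longleftrightarrow> separable_space X \<and> completely_metrizable_space X"

definition lower_semicontinuous :: "('a::topological_space \<Rightarrow> real) \<Rightarrow> bool" where
  "lower_semicontinuous f \<longleftrightarrow> (\<forall>z. \<forall>c<f z. \<forall>\<^sub>F w in nhds z. c < f w)"

definition positive_definite :: "('a \<Rightarrow> 'a \<Rightarrow> real) \<Rightarrow> bool" where
  "positive_definite \<rho> \<longleftrightarrow> (\<forall>x y. \<rho> x y = 0 \<longleftrightarrow> x = y)"

end

theory Submission
  imports Defs
begin

text \<open>Two distinct invariant probability measures yield, after normalising the two parts of the
  Jordan decomposition of their difference, two mutually singular ones \<open>\<mu>\<close> and \<open>\<nu>\<close>. Inner
  regularity (and tightness, if \<open>\<rho>\<close> is only lower semicontinuous) provides sets \<open>F\<^sub>n\<close>, \<open>G\<^sub>n\<close> with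
  \<open>\<rho> > e\<^sub>n > 0\<close> on \<open>F\<^sub>n \<times> G\<^sub>n\<close> and \<open>\<mu> (- F\<^sub>n), \<nu> (- G\<^sub>n) \<le> 4\<^sup>-\<^sup>n\<close>. By the maximal ergodic inequality
  the chain started in \<open>\<mu>\<close> spends asymptotically more than a proportion \<open>2\<^sup>-\<^sup>n\<close> of its time outside
  \<open>F\<^sub>n\<close> with probability at most \<open>2\<^sup>-\<^sup>n\<close>. This event is shift-invariant, so its probability under
  the law of the chain started in \<open>x\<close> is \<open>0\<close> or \<open>1\<close> for \<open>\<mu>\<close>-almost every \<open>x\<close>, and by Borel-Cantelli
  it is \<open>0\<close> for all large \<open>n\<close>. Choosing such an \<open>x\<close> in \<open>M\<close>, and \<open>y\<close> in \<open>M\<close> likewise for \<open>\<nu>\<close>,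
  any generalized coupling inherits these null sets, so that the two paths are \<open>e\<^sub>n\<close>-close at most
  a proportion \<open>2 * 2\<^sup>-\<^sup>n\<close> of the time, which is less than \<open>\<alpha>\<close> for large \<open>n\<close>.\<close>

section \<open>The law of the Markov chain\<close>

abbreviation path_space :: "'a measure \<Rightarrow> (nat \<Rightarrow> 'a) measure" where
  "path_space S \<equiv> Pi\<^sub>M UNIV (\<lambda>_. S)"

lemma shift_measurable: "(\<lambda>\<omega> n. \<omega> (Suc n)) \<in> path_space S \<rightarrow>\<^sub>M path_space S"
  by (rule measurable_PiM_single') (auto simp: space_PiM PiE_iff)

lemma case_nat_measurable: "x \<in> space S \<Longrightarrow> case_nat x \<in> path_space S \<rightarrow>\<^sub>M path_space S"
proof (rule measurable_PiM_single')
  show "(\<lambda>\<omega>. case_nat x \<omega> i) \<in> path_space S \<rightarrow>\<^sub>M S" if "x \<in> space S" for i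
    using that by (cases i) simp_all
qed (auto simp: space_PiM PiE_iff split: nat.split)

text \<open>Finitely many indices lie below a common bound, and unconstrained coordinates get the
  whole space. The bound has the form \<open>Suc n\<close> so that the first-step formula, which
  needs at least one transition, applies to the resulting box.\<close>

lemma prod_algebra_nat_box:
  assumes "X \<in> prod_algebra UNIV (\<lambda>_::nat. S)"
  obtains n A where "\<And>i. A i \<in> sets S" "X = {\<omega> \<in> space (Pi\<^sub>M UNIV (\<lambda>_. S)). \<forall>i\<le>Suc n. \<omega> i \<in> A i}"
proof -
  from assms obtain J E where X: "X = prod_emb UNIV (\<lambda>_. S) J (Pi\<^sub>E J E)"
    and J: "finite J" "\<And>i. i \<in> J \<Longrightarrow> E i \<in> sets S"
    by (rule prod_algebraE) auto
  obtain n where n: "i \<in> J \<Longrightarrow> i \<le> Suc n" for i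
    using J(1) finite_nat_set_iff_bounded_le by (metis le_SucI)
  define A where "A i = (if i \<in> J then E i else space S)" for i
  show thesis
  proof (rule that)
    show "A i \<in> sets S" for i
      using J by (simp add: A_def)
    show "X = {\<omega> \<in> space (Pi\<^sub>M UNIV (\<lambda>_. S)). \<forall>i\<le>Suc n. \<omega> i \<in> A i}"
      unfolding X using n by (auto simp: A_def prod_emb_iff space_PiM PiE_iff)
  qed
qed

lemma indicator_box:
  "\<omega> \<in> space (Pi\<^sub>M UNIV (\<lambda>_. S)) \<Longrightarrow>
    indicator {\<omega> \<in> space (Pi\<^sub>M UNIV (\<lambda>_. S)). \<forall>i\<le>n. \<omega> i \<in> A i} \<omega> =
      (\<Prod>i\<le>n::nat. indicator (A i) (\<omega> i) :: ennreal)"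
  by (auto simp: indicator_def prod_zero_iff)

text \<open>Brings cylinder probabilities into the form on which the one-step formulas below
  act.\<close>

lemma chain_law_box:
  assumes K: "markov_kernel S K" and x: "x \<in> space S" and A: "\<And>i. A i \<in> sets S"
  shows "emeasure (chain_law S K x) {\<omega> \<in> space (Pi\<^sub>M UNIV (\<lambda>_. S)). \<forall>i\<le>n. \<omega> i \<in> A i} =
    (\<integral>\<^sup>+\<omega>. (\<Prod>i\<le>n. indicator (A i) (\<omega> i)) \<partial>chain_law S K x)"
proof -
  note [measurable_cong] = sets_chain_law[OF K x]
  note [measurable] = A
  have [simp]: "space (chain_law S K x) = space (Pi\<^sub>M UNIV (\<lambda>_. S))"
    using sets_chain_law[OF K x] by (rule sets_eq_imp_space_eq)
  have "emeasure (chain_law S K x) {\<omega> \<in> space (Pi\<^sub>M UNIV (\<lambda>_. S)). \<forall>i\<le>n. \<omega> i \<in> A i} =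
    (\<integral>\<^sup>+\<omega>. indicator {\<omega> \<in> space (Pi\<^sub>M UNIV (\<lambda>_. S)). \<forall>i\<le>n. \<omega> i \<in> A i} \<omega> \<partial>chain_law S K x)"
    by (subst nn_integral_indicator) simp_all
  also have "\<dots> = (\<integral>\<^sup>+\<omega>. (\<Prod>i\<le>n. indicator (A i) (\<omega> i)) \<partial>chain_law S K x)"
    by (intro nn_integral_cong) (simp add: indicator_box)
  finally show ?thesis .
qed

lemma markov_kernel_measurable:
  assumes "markov_kernel S K"
  shows "K \<in> S \<rightarrow>\<^sub>M subprob_algebra S"
  using assms by (simp add: markov_kernel_def measurable_prob_algebraD)

lemma nn_integral_kernel_measurable:
  assumes "markov_kernel S K" and [measurable]: "f \<in> borel_measurable S"
  shows "(\<lambda>x. \<integral>\<^sup>+y. f y \<partial>K x) \<in> borel_measurable S"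
  using nn_integral_measurable_subprob_algebra[OF assms(2)] markov_kernel_measurable[OF assms(1)]
  by (rule measurable_compose[rotated])

lemma nn_integral_chain_law_0:
  assumes K: "markov_kernel S K" and x: "x \<in> space S" and [measurable]: "f \<in> borel_measurable S"
  shows "(\<integral>\<^sup>+\<omega>. f (\<omega> 0) \<partial>chain_law S K x) = f x"
proof -
  note [measurable_cong] = sets_chain_law[OF K x]
  have "(\<integral>\<^sup>+\<omega>. f (\<omega> 0) \<partial>chain_law S K x) = (\<integral>\<^sup>+y. f y \<partial>distr (chain_law S K x) S (\<lambda>\<omega>. \<omega> 0))"
    by (subst nn_integral_distr) simp_all
  also have "\<dots> = f x"
    using x by (simp add: chain_law_initial[OF K x] nn_integral_return)
  finally show ?thesis .
qed

text \<open>By \<open>chain_law_step\<close>, the law of the coordinates up to n + 1 arises from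
  that of the coordinates up to n by one draw from the kernel. The draw changes coordinate n + 1
  only, so the other factors leave the inner integral. The factors are general functions, not
  indicators, because transitions get absorbed into them later.\<close>

lemma nn_integral_chain_law_last_step:
  assumes K: "markov_kernel S K" and x: "x \<in> space S"
    and f[measurable]: "\<And>i. f i \<in> borel_measurable S"
  shows "(\<integral>\<^sup>+\<omega>. (\<Prod>i\<le>Suc n. f i (\<omega> i)) \<partial>chain_law S K x) =
    (\<integral>\<^sup>+\<omega>. (\<Prod>i\<le>n. f i (\<omega> i)) * (\<integral>\<^sup>+y. f (Suc n) y \<partial>K (\<omega> n)) \<partial>chain_law S K x)"
proof -
  let ?L = "chain_law S K x"
  let ?P = "\<lambda>m. Pi\<^sub>M {0..<m} (\<lambda>_::nat. S)"
  note [measurable_cong] = sets_chain_law[OF K x]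
  have Kp: "K \<in> S \<rightarrow>\<^sub>M prob_algebra S"
    using K by (simp add: markov_kernel_def)
  note [measurable] = nn_integral_kernel_measurable[OF K] Kp
  have r[measurable]: "(\<lambda>\<omega>. restrict \<omega> {0..<m}) \<in> ?L \<rightarrow>\<^sub>M ?P m" for m
    unfolding measurable_cong_sets[OF sets_chain_law[OF K x] refl]
    by (rule measurable_restrict_subset) simp
  have c[measurable]: "(\<lambda>\<omega>. \<omega> i) \<in> ?P m \<rightarrow>\<^sub>M S" if "i < m" for i m
    using that by (intro measurable_component_singleton) simp
  have step: "(\<lambda>\<omega>. distr (K (\<omega> n)) (?P (Suc (Suc n))) (fun_upd \<omega> (Suc n)))
      \<in> ?P (Suc n) \<rightarrow>\<^sub>M subprob_algebra (?P (Suc (Suc n)))"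
  proof (rule measurable_prob_algebraD, rule measurable_distr_prob_space2)
    show "(\<lambda>\<omega>. K (\<omega> n)) \<in> ?P (Suc n) \<rightarrow>\<^sub>M prob_algebra S"
      by measurable
    show "(\<lambda>(\<omega>, y). fun_upd \<omega> (Suc n) y) \<in> ?P (Suc n) \<Otimes>\<^sub>M S \<rightarrow>\<^sub>M ?P (Suc (Suc n))"
      unfolding case_prod_beta
      by (rule measurable_fun_upd[where J="{0..<Suc n}"]) auto
  qed
  have prod[measurable]: "(\<lambda>\<omega>. \<Prod>i\<le>k. f i (\<omega> i)) \<in> borel_measurable (?P m)" if "k < m" for k m
    using that by (intro borel_measurable_prod_ennreal) simp
  have "(\<integral>\<^sup>+\<omega>. (\<Prod>i\<le>Suc n. f i (\<omega> i)) \<partial>?L) =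
      (\<integral>\<^sup>+\<omega>. (\<Prod>i\<le>Suc n. f i (restrict \<omega> {0..<Suc (Suc n)} i)) \<partial>?L)"
    by (intro nn_integral_cong prod.cong) auto
  also have "\<dots> = (\<integral>\<^sup>+\<omega>. (\<Prod>i\<le>Suc n. f i (\<omega> i))
      \<partial>distr ?L (?P (Suc (Suc n))) (\<lambda>\<omega>. restrict \<omega> {0..<Suc (Suc n)}))"
    by (subst nn_integral_distr) auto
  also have "\<dots> = (\<integral>\<^sup>+\<omega>. \<integral>\<^sup>+\<omega>'. (\<Prod>i\<le>Suc n. f i (\<omega>' i))
      \<partial>distr (K (\<omega> n)) (?P (Suc (Suc n))) (fun_upd \<omega> (Suc n))
      \<partial>distr ?L (?P (Suc n)) (\<lambda>\<omega>. restrict \<omega> {0..<Suc n}))"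
    unfolding chain_law_step[OF K x]
    by (rule nn_integral_bind[OF prod]) (use step in simp_all)
  also have "\<dots> = (\<integral>\<^sup>+\<omega>. (\<Prod>i\<le>n. f i (\<omega> i)) * (\<integral>\<^sup>+y. f (Suc n) y \<partial>K (\<omega> n))
      \<partial>distr ?L (?P (Suc n)) (\<lambda>\<omega>. restrict \<omega> {0..<Suc n}))"
  proof (rule nn_integral_cong)
    fix \<omega> assume "\<omega> \<in> space (distr ?L (?P (Suc n)) (\<lambda>\<omega>. restrict \<omega> {0..<Suc n}))"
    then have \<omega>: "\<omega> \<in> space (?P (Suc n))"
      by simp
    then have "\<omega> n \<in> space S"
      by (auto simp: space_PiM)
    then have [measurable_cong]: "sets (K (\<omega> n)) = sets S"
      using K by (simp add: markov_kernel_iff)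
    have u: "fun_upd \<omega> (Suc n) \<in> K (\<omega> n) \<rightarrow>\<^sub>M ?P (Suc (Suc n))"
      by (rule measurable_fun_upd[where J="{0..<Suc n}"]) (use \<omega> \<open>sets (K (\<omega> n)) = sets S\<close> in \<open>auto intro: measurable_ident_sets\<close>)
    have "(\<integral>\<^sup>+\<omega>'. (\<Prod>i\<le>Suc n. f i (\<omega>' i)) \<partial>distr (K (\<omega> n)) (?P (Suc (Suc n))) (fun_upd \<omega> (Suc n))) =
        (\<integral>\<^sup>+y. (\<Prod>i\<le>n. f i (\<omega> i)) * f (Suc n) y \<partial>K (\<omega> n))"
      by (subst nn_integral_distr[OF u]) (auto intro!: nn_integral_cong prod.cong)
    then show "(\<integral>\<^sup>+\<omega>'. (\<Prod>i\<le>Suc n. f i (\<omega>' i)) \<partial>distr (K (\<omega> n)) (?P (Suc (Suc n))) (fun_upd \<omega> (Suc n))) =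
        (\<Prod>i\<le>n. f i (\<omega> i)) * (\<integral>\<^sup>+y. f (Suc n) y \<partial>K (\<omega> n))"
      by (subst nn_integral_cmult[symmetric]) (simp_all add: measurable_cong_sets[OF \<open>sets (K (\<omega> n)) = sets S\<close> refl])
  qed
  also have "\<dots> = (\<integral>\<^sup>+\<omega>. (\<Prod>i\<le>n. f i (restrict \<omega> {0..<Suc n} i)) *
      (\<integral>\<^sup>+y. f (Suc n) y \<partial>K (restrict \<omega> {0..<Suc n} n)) \<partial>?L)"
    by (subst nn_integral_distr) auto
  also have "\<dots> = (\<integral>\<^sup>+\<omega>. (\<Prod>i\<le>n. f i (\<omega> i)) * (\<integral>\<^sup>+y. f (Suc n) y \<partial>K (\<omega> n)) \<partial>?L)"
    by (intro nn_integral_cong arg_cong2[where f="(*)"] prod.cong) auto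
  finally show ?thesis .
qed

text \<open>Induction on n: the last transition is absorbed into the factor at index
  \<open>Suc n\<close>, the induction hypothesis splits off the first transition, and the last-step
  formula, now for the chain started in \<open>y\<close>, restores the absorbed one.\<close>

lemma nn_integral_chain_law_first_step:
  assumes K: "markov_kernel S K" and x: "x \<in> space S"
    and f: "\<And>i. f i \<in> borel_measurable S"
  shows "(\<integral>\<^sup>+\<omega>. (\<Prod>i\<le>Suc n. f i (\<omega> i)) \<partial>chain_law S K x) =
    f 0 x * (\<integral>\<^sup>+y. (\<integral>\<^sup>+\<omega>. (\<Prod>i\<le>n. f (Suc i) (\<omega> i)) \<partial>chain_law S K y) \<partial>K x)"
  using f
proof (induction n arbitrary: f)
  case 0
  note [measurable] = 0 nn_integral_kernel_measurable[OF K]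
  have "space (K x) = space S"
    using K x by (auto simp: markov_kernel_iff dest: sets_eq_imp_space_eq)
  then have "(\<integral>\<^sup>+y. (\<integral>\<^sup>+\<omega>. f (Suc 0) (\<omega> 0) \<partial>chain_law S K y) \<partial>K x) = (\<integral>\<^sup>+y. f (Suc 0) y \<partial>K x)"
    by (intro nn_integral_cong nn_integral_chain_law_0[OF K]) auto
  moreover have "(\<integral>\<^sup>+\<omega>. f 0 (\<omega> 0) * (\<integral>\<^sup>+y. f (Suc 0) y \<partial>K (\<omega> 0)) \<partial>chain_law S K x) =
      f 0 x * (\<integral>\<^sup>+y. f (Suc 0) y \<partial>K x)"
    by (rule nn_integral_chain_law_0[OF K x, where f="\<lambda>z. f 0 z * (\<integral>\<^sup>+y. f (Suc 0) y \<partial>K z)"]) simp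
  ultimately show ?case
    using nn_integral_chain_law_last_step[where f=f and n=0, OF K x 0] by simp
next
  case (Suc n)
  note [measurable] = Suc.prems nn_integral_kernel_measurable[OF K]
  define g where "g i z = (if i = Suc n then f (Suc n) z * (\<integral>\<^sup>+y. f (Suc (Suc n)) y \<partial>K z) else f i z)" for i z
  have g: "g i \<in> borel_measurable S" for i
    unfolding g_def by (cases "i = Suc n") simp_all
  have sp: "space (K x) = space S"
    using K x by (auto simp: markov_kernel_iff dest: sets_eq_imp_space_eq)
  have "(\<integral>\<^sup>+\<omega>. (\<Prod>i\<le>Suc (Suc n). f i (\<omega> i)) \<partial>chain_law S K x) =
      (\<integral>\<^sup>+\<omega>. (\<Prod>i\<le>Suc n. g i (\<omega> i)) \<partial>chain_law S K x)"
    unfolding nn_integral_chain_law_last_step[OF K x Suc.prems]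
    by (intro nn_integral_cong) (simp add: g_def mult_ac)
  also have "\<dots> = g 0 x * (\<integral>\<^sup>+y. (\<integral>\<^sup>+\<omega>. (\<Prod>i\<le>n. g (Suc i) (\<omega> i)) \<partial>chain_law S K y) \<partial>K x)"
    by (rule Suc.IH) (rule g)
  also have "(\<integral>\<^sup>+y. (\<integral>\<^sup>+\<omega>. (\<Prod>i\<le>n. g (Suc i) (\<omega> i)) \<partial>chain_law S K y) \<partial>K x) =
      (\<integral>\<^sup>+y. (\<integral>\<^sup>+\<omega>. (\<Prod>i\<le>Suc n. f (Suc i) (\<omega> i)) \<partial>chain_law S K y) \<partial>K x)"
  proof (rule nn_integral_cong)
    fix y assume "y \<in> space (K x)"
    then have y: "y \<in> space S"
      by (simp add: sp)
    show "(\<integral>\<^sup>+\<omega>. (\<Prod>i\<le>n. g (Suc i) (\<omega> i)) \<partial>chain_law S K y) =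
        (\<integral>\<^sup>+\<omega>. (\<Prod>i\<le>Suc n. f (Suc i) (\<omega> i)) \<partial>chain_law S K y)"
      unfolding nn_integral_chain_law_last_step[OF K y Suc.prems]
    proof (rule nn_integral_cong)
      fix \<omega> :: "nat \<Rightarrow> 'a"
      have "(\<Prod>i<n. g (Suc i) (\<omega> i)) = (\<Prod>i<n. f (Suc i) (\<omega> i))"
        by (intro prod.cong) (auto simp: g_def)
      then show "(\<Prod>i\<le>n. g (Suc i) (\<omega> i)) =
          (\<Prod>i\<le>n. f (Suc i) (\<omega> i)) * (\<integral>\<^sup>+y. f (Suc (Suc n)) y \<partial>K (\<omega> n))"
        by (simp add: lessThan_Suc_atMost[symmetric] g_def mult_ac)
    qed
  qed
  finally show ?case
    by (simp add: g_def)
qed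

text \<open>Boxes form an intersection-stable generator. Their probabilities are measurable in the
  starting point by induction on the length, since the first-step formula expresses each as a kernel
  integral of a shorter one.\<close>

lemma chain_law_measurable:
  assumes K: "markov_kernel S K"
  shows "chain_law S K \<in> S \<rightarrow>\<^sub>M prob_algebra (Pi\<^sub>M UNIV (\<lambda>_. S))"
proof (rule measurable_prob_algebra_generated[OF sets_PiM Int_stable_prod_algebra prod_algebra_sets_into_space])
  have box: "(\<lambda>x. \<integral>\<^sup>+\<omega>. (\<Prod>i\<le>n. indicator (A i) (\<omega> i)) \<partial>chain_law S K x) \<in> borel_measurable S"
    if "\<And>i. A i \<in> sets S" for A and n :: nat
    using that
  proof (induction n arbitrary: A)
    case 0
    note [measurable] = 0
    show ?case
      by (subst measurable_cong[where g="indicator (A 0)"])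
        (use nn_integral_chain_law_0[OF K, of _ "indicator (A 0)"] in simp_all)
  next
    case (Suc n)
    note [measurable] = Suc.prems Suc.IH nn_integral_kernel_measurable[OF K]
    show ?case
      by (subst measurable_cong[OF nn_integral_chain_law_first_step[OF K]]) simp_all
  qed
  show "(\<lambda>x. emeasure (chain_law S K x) X) \<in> borel_measurable S"
    if X: "X \<in> prod_algebra UNIV (\<lambda>_. S)" for X
  proof -
    from X obtain n A where A: "\<And>i. A i \<in> sets S"
      and Xe: "X = {\<omega> \<in> space (Pi\<^sub>M UNIV (\<lambda>_. S)). \<forall>i\<le>Suc n. \<omega> i \<in> A i}"
      by (rule prod_algebra_nat_box) blast
    show ?thesis
      unfolding Xe by (subst measurable_cong[OF chain_law_box[OF K _ A]]) (simp_all only: box[OF A])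
  qed
qed (simp_all add: prob_space_chain_law[OF K] sets_chain_law[OF K])

text \<open>This is the Markov property at time one: draw the next state \<open>y\<close>, run the
  chain from \<open>y\<close> and prepend \<open>x\<close>. The two sides are compared on boxes,
  whose preimage under prepending is the tail box or empty, so that the first-step formula
  applies.\<close>

lemma chain_law_markov:
  assumes K: "markov_kernel S K" and x: "x \<in> space S"
  shows "chain_law S K x =
    K x \<bind> (\<lambda>y. distr (chain_law S K y) (Pi\<^sub>M UNIV (\<lambda>_. S)) (case_nat x))"
proof -
  let ?L = "chain_law S K" and ?\<Pi> = "Pi\<^sub>M UNIV (\<lambda>_::nat. S)"
  have Kx: "K x \<in> space (prob_algebra S)" and ne: "space (K x) = space S"
    using K x by (auto simp: markov_kernel_iff space_prob_algebra dest: sets_eq_imp_space_eq)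
  note cons = case_nat_measurable[OF x]
  have cp: "(\<lambda>y. distr (?L y) ?\<Pi> (case_nat x)) \<in> S \<rightarrow>\<^sub>M prob_algebra ?\<Pi>"
    by (rule measurable_compose[OF chain_law_measurable[OF K] measurable_distr_prob_space[OF cons]])
  note sl = sets_chain_law[OF K] and spl = sets_eq_imp_space_eq[OF sets_chain_law[OF K]]
  show ?thesis
  proof (rule measure_eqI_generator_eq[OF Int_stable_prod_algebra prod_algebra_sets_into_space])
    show "emeasure (?L x) X = emeasure (K x \<bind> (\<lambda>y. distr (?L y) ?\<Pi> (case_nat x))) X"
      if X: "X \<in> prod_algebra UNIV (\<lambda>_. S)" for X
    proof -
      from X obtain n A where A[measurable]: "\<And>i. A i \<in> sets S"
        and Xe: "X = {\<omega> \<in> space ?\<Pi>. \<forall>i\<le>Suc n. \<omega> i \<in> A i}"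
        by (rule prod_algebra_nat_box) blast
      have X_sets: "X \<in> sets ?\<Pi>"
        using X by (auto simp: sets_PiM)
      have "emeasure (K x \<bind> (\<lambda>y. distr (?L y) ?\<Pi> (case_nat x))) X =
          (\<integral>\<^sup>+y. emeasure (distr (?L y) ?\<Pi> (case_nat x)) X \<partial>K x)"
        by (rule emeasure_bind_prob_algebra[OF Kx cp X_sets])
      also have "\<dots> = (\<integral>\<^sup>+y. indicator (A 0) x * (\<integral>\<^sup>+\<omega>. (\<Prod>i\<le>n. indicator (A (Suc i)) (\<omega> i)) \<partial>?L y) \<partial>K x)"
      proof (rule nn_integral_cong)
        fix y assume "y \<in> space (K x)"
        then have y: "y \<in> space S"
          by (simp add: ne)
        have "emeasure (distr (?L y) ?\<Pi> (case_nat x)) X = emeasure (?L y) (case_nat x -` X \<inter> space ?\<Pi>)"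
          using X_sets by (subst emeasure_distr) (simp_all add: spl y measurable_cong_sets[OF sl[OF y] refl] cons)
        also have "case_nat x -` X \<inter> space ?\<Pi> =
            (if x \<in> A 0 then {\<omega> \<in> space ?\<Pi>. \<forall>i\<le>n. \<omega> i \<in> A (Suc i)} else {})"
          using x unfolding Xe
          by (auto simp: space_PiM PiE_iff le_Suc_eq All_less_Suc2 split: nat.split)
             (metis (no_types, lifting) Suc_le_mono le_SucE nat.case(2) not0_implies_Suc)+
        also have "emeasure (?L y) \<dots> =
            indicator (A 0) x * (\<integral>\<^sup>+\<omega>. (\<Prod>i\<le>n. indicator (A (Suc i)) (\<omega> i)) \<partial>?L y)"
          by (simp add: chain_law_box[OF K y A])
        finally show "emeasure (distr (?L y) ?\<Pi> (case_nat x)) X = \<dots>" .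
      qed
      also have "\<dots> = indicator (A 0) x * (\<integral>\<^sup>+y. (\<integral>\<^sup>+\<omega>. (\<Prod>i\<le>n. indicator (A (Suc i)) (\<omega> i)) \<partial>?L y) \<partial>K x)"
        by (cases "x \<in> A 0") simp_all
      also have "\<dots> = emeasure (?L x) X"
        unfolding Xe chain_law_box[OF K x A]
        by (subst nn_integral_chain_law_first_step[OF K x]) simp_all
      finally show ?thesis ..
    qed
    show "sets (?L x) = sigma_sets (\<Pi>\<^sub>E i\<in>UNIV. space S) (prod_algebra UNIV (\<lambda>_. S))"
      by (simp add: sl x sets_PiM)
    show "sets (K x \<bind> (\<lambda>y. distr (?L y) ?\<Pi> (case_nat x))) = sigma_sets (\<Pi>\<^sub>E i\<in>UNIV. space S) (prod_algebra UNIV (\<lambda>_. S))"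
      by (simp add: sets_bind'[OF Kx cp] sets_PiM)
    show "range (\<lambda>i::nat. \<Pi>\<^sub>E i\<in>UNIV. space S) \<subseteq> prod_algebra UNIV (\<lambda>_. S)"
      using space_in_prod_algebra[of UNIV "\<lambda>_. S"] by auto
    show "emeasure (?L x) (\<Pi>\<^sub>E i\<in>UNIV. space S) \<noteq> \<infinity>"
      using prob_space_chain_law[OF K x] by (simp add: finite_measure.emeasure_finite prob_space_def)
  qed auto
qed

section \<open>Zero-one law for shift-invariant events\<close>

lemma pred_eq_ennreal:
  fixes f g :: "'a \<Rightarrow> ennreal"
  assumes [measurable]: "f \<in> borel_measurable M" "g \<in> borel_measurable M"
  shows "Measurable.pred M (\<lambda>x. f x = g x)"
  by measurable

context
  fixes S :: "'a measure" and K :: "'a \<Rightarrow> 'a measure"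
  assumes K: "markov_kernel S K"
begin

lemma space_markov_kernel: "x \<in> space S \<Longrightarrow> space (K x) = space S"
  using K by (auto simp: markov_kernel_iff dest: sets_eq_imp_space_eq)

lemma space_chain_law: "x \<in> space S \<Longrightarrow> space (chain_law S K x) = space (path_space S)"
  using K by (intro sets_eq_imp_space_eq sets_chain_law)

lemma chain_law_subprob_measurable: "chain_law S K \<in> S \<rightarrow>\<^sub>M subprob_algebra (path_space S)"
  by (intro measurable_prob_algebraD chain_law_measurable K)

lemma emeasure_chain_law_measurable:
  "X \<in> sets (path_space S) \<Longrightarrow> (\<lambda>x. emeasure (chain_law S K x) X) \<in> borel_measurable S"
  using measurable_emeasure_subprob_algebra chain_law_subprob_measurable
  by (rule measurable_compose[rotated])

lemma emeasure_chain_law_markov: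
  assumes x: "x \<in> space S" and X: "X \<in> sets (path_space S)"
  shows "emeasure (chain_law S K x) X =
    (\<integral>\<^sup>+y. emeasure (chain_law S K y) (case_nat x -` X \<inter> space (path_space S)) \<partial>K x)"
proof -
  have "K x \<in> space (prob_algebra S)"
    using K x by (simp add: markov_kernel_iff space_prob_algebra)
  then have "emeasure (chain_law S K x) X =
      (\<integral>\<^sup>+y. emeasure (distr (chain_law S K y) (path_space S) (case_nat x)) X \<partial>K x)"
    by (subst chain_law_markov[OF K x], rule emeasure_bind_prob_algebra[OF _ _ X])
       (rule measurable_compose[OF chain_law_measurable[OF K]
         measurable_distr_prob_space[OF case_nat_measurable[OF x]]])
  also have "\<dots> = (\<integral>\<^sup>+y. emeasure (chain_law S K y) (case_nat x -` X \<inter> space (path_space S)) \<partial>K x)"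
    using X case_nat_measurable[OF x]
    by (intro nn_integral_cong, subst emeasure_distr)
       (simp_all add: space_markov_kernel x space_chain_law measurable_cong_sets[OF sets_chain_law[OF K] refl])
  finally show ?thesis .
qed

section \<open>The stationary path measure of an invariant measure\<close>

context
  fixes \<mu> :: "'a measure"
  assumes inv: "invariant_prob S K \<mu>"
begin

lemma prob_space_invariant: "prob_space \<mu>"
  and sets_invariant: "sets \<mu> = sets S"
  and space_invariant: "space \<mu> = space S"
  and bind_invariant: "\<mu> \<bind> K = \<mu>"
  using inv by (auto simp: invariant_prob_def dest: sets_eq_imp_space_eq)

lemma kernel_measurable_invariant: "K \<in> \<mu> \<rightarrow>\<^sub>M subprob_algebra S"
  using markov_kernel_measurable[OF K] by (simp add: measurable_cong_sets[OF sets_invariant refl])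

lemma nn_integral_invariant:
  assumes "f \<in> borel_measurable S"
  shows "(\<integral>\<^sup>+x. \<integral>\<^sup>+y. f y \<partial>K x \<partial>\<mu>) = (\<integral>\<^sup>+x. f x \<partial>\<mu>)"
  using nn_integral_bind[OF assms kernel_measurable_invariant] by (simp add: bind_invariant)

lemma AE_invariant:
  assumes "AE x in \<mu>. Q x" and "Measurable.pred S Q"
  shows "AE x in \<mu>. AE y in K x. Q y"
  using AE_bind[OF kernel_measurable_invariant assms(2)] assms(1) unfolding bind_invariant by blast

lemma emeasure_stationary:
  assumes "X \<in> sets (path_space S)"
  shows "emeasure (\<mu> \<bind> chain_law S K) X = (\<integral>\<^sup>+x. emeasure (chain_law S K x) X \<partial>\<mu>)"
  using prob_space.not_empty[OF prob_space_invariant] _ assms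
  by (rule emeasure_bind)
    (use chain_law_subprob_measurable in \<open>simp add: measurable_cong_sets[OF sets_invariant refl]\<close>)

lemma stationary_in_prob_algebra: "\<mu> \<bind> chain_law S K \<in> space (prob_algebra (path_space S))"
proof -
  have "\<mu> \<in> space (prob_algebra S)"
    using prob_space_invariant sets_invariant by (simp add: space_prob_algebra)
  then show ?thesis
    using chain_law_measurable[OF K] by (simp add: space_prob_algebra sets_bind' prob_space_bind')
qed

lemma sets_stationary: "sets (\<mu> \<bind> chain_law S K) = sets (path_space S)"
  and prob_space_stationary: "prob_space (\<mu> \<bind> chain_law S K)"
  and space_stationary: "space (\<mu> \<bind> chain_law S K) = space (path_space S)"
  using stationary_in_prob_algebra by (auto simp: space_prob_algebra dest: sets_eq_imp_space_eq)

text \<open>Shifting undoes prepending, so by the Markov property the shifted chain from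
  \<open>x\<close> is the chain started from a draw of \<open>K x\<close>; invariance then removes
  this extra step.\<close>

lemma distr_shift_stationary:
  "distr (\<mu> \<bind> chain_law S K) (\<mu> \<bind> chain_law S K) (\<lambda>\<omega> n. \<omega> (Suc n)) = \<mu> \<bind> chain_law S K"
proof (rule measure_eqI)
  let ?N = "\<mu> \<bind> chain_law S K"
  fix X assume "X \<in> sets (distr ?N ?N (\<lambda>\<omega> n. \<omega> (Suc n)))"
  then have X: "X \<in> sets (path_space S)"
    by (simp add: sets_stationary)
  have shift: "(\<lambda>\<omega> n. \<omega> (Suc n)) \<in> ?N \<rightarrow>\<^sub>M ?N"
    using shift_measurable by (simp add: measurable_cong_sets[OF sets_stationary sets_stationary])
  have pre: "(\<lambda>\<omega> n. \<omega> (Suc n)) -` X \<inter> space (path_space S) \<in> sets (path_space S)"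
    using shift_measurable X by (rule measurable_sets)
  have "emeasure (distr ?N ?N (\<lambda>\<omega> n. \<omega> (Suc n))) X =
      emeasure ?N ((\<lambda>\<omega> n. \<omega> (Suc n)) -` X \<inter> space (path_space S))"
    using shift X by (simp add: emeasure_distr sets_stationary space_stationary)
  also have "\<dots> = (\<integral>\<^sup>+x. \<integral>\<^sup>+y. emeasure (chain_law S K y) X \<partial>K x \<partial>\<mu>)"
    unfolding emeasure_stationary[OF pre]
  proof (rule nn_integral_cong)
    fix x assume "x \<in> space \<mu>"
    then have x: "x \<in> space S"
      by (simp add: space_invariant)
    have "case_nat x -` ((\<lambda>\<omega> n. \<omega> (Suc n)) -` X \<inter> space (path_space S)) \<inter> space (path_space S) = X"
      using x sets.sets_into_space[OF X] measurable_space[OF case_nat_measurable[OF x]] by auto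
    then show "emeasure (chain_law S K x) ((\<lambda>\<omega> n. \<omega> (Suc n)) -` X \<inter> space (path_space S)) =
        (\<integral>\<^sup>+y. emeasure (chain_law S K y) X \<partial>K x)"
      by (simp add: emeasure_chain_law_markov[OF x pre])
  qed
  also have "\<dots> = emeasure ?N X"
    by (simp add: nn_integral_invariant emeasure_chain_law_measurable X emeasure_stationary)
  finally show "emeasure (distr ?N ?N (\<lambda>\<omega> n. \<omega> (Suc n))) X = emeasure ?N X" .
qed simp

context
  fixes B :: "(nat \<Rightarrow> 'a) set"
  assumes B: "B \<in> sets (path_space S)"
    and shift: "\<And>\<omega>. \<omega> \<in> space (path_space S) \<Longrightarrow> (\<lambda>n. \<omega> (Suc n)) \<in> B \<longleftrightarrow> \<omega> \<in> B"
begin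

lemma case_nat_shift_invariant:
  "x \<in> space S \<Longrightarrow> \<omega> \<in> space (path_space S) \<Longrightarrow> case_nat x \<omega> \<in> B \<longleftrightarrow> \<omega> \<in> B"
  using shift[OF measurable_space[OF case_nat_measurable]] by force

text \<open>Prepending a state does not change membership in \<open>B\<close>, so the Markov
  property turns into harmonicity.\<close>

lemma shift_invariant_harmonic:
  assumes x: "x \<in> space S"
  shows "(\<integral>\<^sup>+y. emeasure (chain_law S K y) B \<partial>K x) = emeasure (chain_law S K x) B"
proof -
  have "case_nat x -` B \<inter> space (path_space S) = B"
    using sets.sets_into_space[OF B] case_nat_shift_invariant[OF x] by auto
  then show ?thesis
    by (simp add: emeasure_chain_law_markov[OF x B])
qed

text \<open>A bounded harmonic function has conditional variance \<open>K h\<^sup>2 - h\<^sup>2\<close>, whose integral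
  under an invariant measure vanishes.\<close>

lemma AE_shift_invariant_const:
  "AE x in \<mu>. AE y in K x. emeasure (chain_law S K y) B = emeasure (chain_law S K x) B"
proof -
  define h where "h x = measure (chain_law S K x) B" for x
  have h01: "0 \<le> h x \<and> h x \<le> 1" if "x \<in> space S" for x
    using prob_space.prob_le_1[OF prob_space_chain_law[OF K that]] by (simp add: h_def)
  have eh: "emeasure (chain_law S K x) B = ennreal (h x)" if "x \<in> space S" for x
    using prob_space_chain_law[OF K that]
    by (simp add: h_def prob_space_def finite_measure.emeasure_eq_measure)
  have h[measurable]: "h \<in> borel_measurable S"
    unfolding h_def measure_def using emeasure_chain_law_measurable[OF B] by measurable
  define v where "v x = (\<integral>\<^sup>+y. ennreal ((h y - h x)\<^sup>2) \<partial>K x)" for x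
  have v_meas: "v \<in> borel_measurable S"
    unfolding v_def
    by (rule nn_integral_measurable_subprob_algebra2[OF _ markov_kernel_measurable[OF K]]) measurable
  \<comment> \<open>By harmonicity the mean of \<open>h\<close> under \<open>K x\<close> is
    \<open>h x\<close>, hence \<open>v x\<close> is the variance of \<open>h\<close> under
    \<open>K x\<close>.\<close>
  have var: "v x + ennreal ((h x)\<^sup>2) = (\<integral>\<^sup>+y. ennreal ((h y)\<^sup>2) \<partial>K x)" if x: "x \<in> space S" for x
  proof -
    interpret Kx: prob_space "K x"
      using K x by (simp add: markov_kernel_iff)
    have [measurable_cong]: "sets (K x) = sets S"
      using K x by (simp add: markov_kernel_iff)
    note sp = space_markov_kernel[OF x]
    have int: "integrable (K x) h" "integrable (K x) (\<lambda>y. (h y)\<^sup>2)"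
      by (rule Kx.integrable_const_bound[where B=1]; use h01 in \<open>auto simp: sp abs_square_le_1\<close>)+
    have "ennreal (\<integral>y. h y \<partial>K x) = (\<integral>\<^sup>+y. ennreal (h y) \<partial>K x)"
      using int h01 by (intro nn_integral_eq_integral[symmetric]) (auto simp: sp)
    also have "\<dots> = (\<integral>\<^sup>+y. emeasure (chain_law S K y) B \<partial>K x)"
      by (intro nn_integral_cong) (simp add: eh sp)
    also have "\<dots> = ennreal (h x)"
      using shift_invariant_harmonic[OF x] by (simp add: eh x)
    finally have mean: "(\<integral>y. h y \<partial>K x) = h x"
      using h01 x by (subst (asm) ennreal_inj) (auto simp: sp intro!: integral_nonneg_AE)
    have "(\<integral>y. (h y - h x)\<^sup>2 \<partial>K x) = (\<integral>y. (h y)\<^sup>2 - 2 * h x * h y + (h x)\<^sup>2 \<partial>K x)"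
      by (intro Bochner_Integration.integral_cong) (auto simp: power2_eq_square algebra_simps)
    also have "\<dots> = (\<integral>y. (h y)\<^sup>2 \<partial>K x) - (h x)\<^sup>2"
      using int by (simp add: mean power2_eq_square Kx.prob_space)
    finally have "(\<integral>y. (h y - h x)\<^sup>2 \<partial>K x) + (h x)\<^sup>2 = (\<integral>y. (h y)\<^sup>2 \<partial>K x)"
      by simp
    moreover have "integrable (K x) (\<lambda>y. (h y - h x)\<^sup>2)"
      using int by (simp add: power2_diff)
    ultimately show ?thesis
      using int unfolding v_def by (simp add: nn_integral_eq_integral ennreal_plus[symmetric] del: ennreal_plus)
  qed
  have "(\<integral>\<^sup>+x. v x \<partial>\<mu>) + (\<integral>\<^sup>+x. ennreal ((h x)\<^sup>2) \<partial>\<mu>) = (\<integral>\<^sup>+x. v x + ennreal ((h x)\<^sup>2) \<partial>\<mu>)"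
    using v_meas h by (intro nn_integral_add[symmetric]) (simp_all add: measurable_cong_sets[OF sets_invariant refl])
  also have "\<dots> = (\<integral>\<^sup>+x. \<integral>\<^sup>+y. ennreal ((h y)\<^sup>2) \<partial>K x \<partial>\<mu>)"
    by (intro nn_integral_cong) (simp add: var space_invariant)
  also have "\<dots> = (\<integral>\<^sup>+x. ennreal ((h x)\<^sup>2) \<partial>\<mu>)"
    by (rule nn_integral_invariant) measurable
  finally have *: "(\<integral>\<^sup>+x. v x \<partial>\<mu>) + (\<integral>\<^sup>+x. ennreal ((h x)\<^sup>2) \<partial>\<mu>) = 0 + (\<integral>\<^sup>+x. ennreal ((h x)\<^sup>2) \<partial>\<mu>)"
    by simp
  have "(\<integral>\<^sup>+x. ennreal ((h x)\<^sup>2) \<partial>\<mu>) \<le> (\<integral>\<^sup>+x. 1 \<partial>\<mu>)"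
    using h01 by (intro nn_integral_mono) (simp add: space_invariant abs_square_le_1)
  then have "(\<integral>\<^sup>+x. ennreal ((h x)\<^sup>2) \<partial>\<mu>) \<noteq> top"
    using prob_space.emeasure_space_1[OF prob_space_invariant] by (auto simp: top_unique)
  \<comment> \<open>Cancelling in \<open>ennreal\<close> requires a finite common summand; it is at
    most 1 because \<open>h\<close> takes values in [0, 1].\<close>
  with * have "(\<integral>\<^sup>+x. v x \<partial>\<mu>) = 0"
    by (subst (asm) (1 2) add.commute, subst (asm) ennreal_add_left_cancel) auto
  then have "AE x in \<mu>. v x = 0"
    using v_meas by (subst (asm) nn_integral_0_iff_AE) (simp_all add: measurable_cong_sets[OF sets_invariant refl])
  with AE_space show ?thesis
  proof eventually_elim
    fix x assume "x \<in> space \<mu>" and v0: "v x = 0"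
    then have x: "x \<in> space S"
      by (simp add: space_invariant)
    have [measurable_cong]: "sets (K x) = sets S"
      using K x by (simp add: markov_kernel_iff)
    have "AE y in K x. ennreal ((h y - h x)\<^sup>2) = 0"
      using v0 unfolding v_def by (subst (asm) nn_integral_0_iff_AE) simp_all
    then show "AE y in K x. emeasure (chain_law S K y) B = emeasure (chain_law S K x) B"
      by (rule AE_mp) (auto simp: space_markov_kernel[OF x] x eh intro!: AE_I2)
  qed
qed

text \<open>One step from \<open>x\<close> almost surely leaves the probability of \<open>B\<close>
  unchanged, so this factor leaves the integral over the next state. Invariance carries the
  hypothesis from \<open>\<mu>\<close>-almost every state to \<open>K x\<close>-almost every next
  state.\<close>

lemma shift_invariant_indep_step:
  assumes X: "X \<in> sets (path_space S)" and A: "A \<in> sets S"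
    and AE: "AE x in \<mu>. emeasure (chain_law S K x) (X \<inter> B) =
      emeasure (chain_law S K x) B * emeasure (chain_law S K x) X"
  defines "Y \<equiv> {\<omega> \<in> space (path_space S). \<omega> 0 \<in> A \<and> (\<lambda>n. \<omega> (Suc n)) \<in> X}"
  shows "AE x in \<mu>. emeasure (chain_law S K x) (Y \<inter> B) =
      emeasure (chain_law S K x) B * emeasure (chain_law S K x) Y"
proof -
  note [measurable] = X A B
  have XB: "X \<inter> B \<in> sets (path_space S)"
    by measurable
  have sets_K: "sets (K x) = sets S" if "x \<in> space S" for x
    using K that by (simp add: markov_kernel_iff)
  have Y[measurable]: "Y \<in> sets (path_space S)"
  proof -
    have "Y = {\<omega> \<in> space (path_space S). \<omega> 0 \<in> A} \<inter>
        ((\<lambda>\<omega> n. \<omega> (Suc n)) -` X \<inter> space (path_space S))"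
      by (auto simp: Y_def)
    also have "\<dots> \<in> sets (path_space S)"
      by (intro sets.Int measurable_sets[OF shift_measurable X]) measurable
    finally show ?thesis .
  qed
  have "AE x in \<mu>. AE y in K x. emeasure (chain_law S K y) (X \<inter> B) =
      emeasure (chain_law S K y) B * emeasure (chain_law S K y) X"
    by (intro AE_invariant[OF AE] pred_eq_ennreal borel_measurable_times_ennreal emeasure_chain_law_measurable XB X B)
  with AE_space AE_shift_invariant_const show ?thesis
  proof eventually_elim
    fix x assume "x \<in> space \<mu>"
    then have x: "x \<in> space S"
      by (simp add: space_invariant)
    assume eq: "AE y in K x. emeasure (chain_law S K y) B = emeasure (chain_law S K x) B"
      "AE y in K x. emeasure (chain_law S K y) (X \<inter> B) =
        emeasure (chain_law S K y) B * emeasure (chain_law S K y) X"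
    have pre: "case_nat x -` Y \<inter> space (path_space S) = (if x \<in> A then X else {})"
      "case_nat x -` (Y \<inter> B) \<inter> space (path_space S) = (if x \<in> A then X \<inter> B else {})"
      using sets.sets_into_space[OF X] measurable_space[OF case_nat_measurable[OF x]]
        case_nat_shift_invariant[OF x] unfolding Y_def by (auto 0 3)
    have YB: "Y \<inter> B \<in> sets (path_space S)"
      by measurable
    have "(\<integral>\<^sup>+y. emeasure (chain_law S K y) (X \<inter> B) \<partial>K x) =
        (\<integral>\<^sup>+y. emeasure (chain_law S K x) B * emeasure (chain_law S K y) X \<partial>K x)"
      using eq by (intro nn_integral_cong_AE) auto
    also have "\<dots> = emeasure (chain_law S K x) B * (\<integral>\<^sup>+y. emeasure (chain_law S K y) X \<partial>K x)"
      using emeasure_chain_law_measurable[OF X]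
      by (intro nn_integral_cmult) (simp add: measurable_cong_sets[OF sets_K[OF x] refl])
    finally show "emeasure (chain_law S K x) (Y \<inter> B) =
        emeasure (chain_law S K x) B * emeasure (chain_law S K x) Y"
      unfolding emeasure_chain_law_markov[OF x YB] emeasure_chain_law_markov[OF x Y] pre by simp
  qed
qed

text \<open>Induction on the number of constrained coordinates, for all sequences \<open>A\<close>
  at once because the step passes to the shifted sequence. The exceptional null set depends on the
  box.\<close>

lemma shift_invariant_indep_box:
  fixes A :: "nat \<Rightarrow> 'a set"
  assumes "\<And>i. A i \<in> sets S"
  defines "X \<equiv> \<lambda>n (A :: nat \<Rightarrow> 'a set). {\<omega> \<in> space (path_space S). \<forall>i<n. \<omega> i \<in> A i}"
  shows "AE x in \<mu>. emeasure (chain_law S K x) (X n A \<inter> B) =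
      emeasure (chain_law S K x) B * emeasure (chain_law S K x) (X n A)"
  using assms(1)
proof (induction n arbitrary: A)
  case 0
  have "X 0 A \<inter> B = B" "X 0 A = space (path_space S)"
    using sets.sets_into_space[OF B] by (auto simp: X_def)
  moreover have "emeasure (chain_law S K x) (space (path_space S)) = 1" if "x \<in> space S" for x
    using prob_space.emeasure_space_1[OF prob_space_chain_law[OF K that]] space_chain_law[OF that] by simp
  ultimately show ?case
    by (auto simp: space_invariant)
next
  case (Suc n)
  have "X (Suc n) A = {\<omega> \<in> space (path_space S). \<omega> 0 \<in> A 0 \<and> (\<lambda>n. \<omega> (Suc n)) \<in> X n (\<lambda>i. A (Suc i))}"
    by (auto simp: X_def All_less_Suc2 measurable_space[OF shift_measurable])
  moreover have "X n (\<lambda>i. A (Suc i)) \<in> sets (path_space S)"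
    unfolding X_def using Suc.prems by measurable
  ultimately show ?case
    using shift_invariant_indep_step[OF _ Suc.prems Suc.IH[of "\<lambda>i. A (Suc i)"]] Suc.prems by simp
qed

text \<open>By the preceding lemma \<open>B\<close> is independent, under almost every \<open>chain_law S K x\<close>,
  of the cylinder sets, hence of itself.\<close>

lemma shift_invariant_zero_one:
  "AE x in \<mu>. emeasure (chain_law S K x) B = 0 \<or> emeasure (chain_law S K x) B = 1"
proof -
  let ?L = "chain_law S K"
  define H where "H x = emeasure (?L x) B" for x
  have [measurable]: "H \<in> borel_measurable S"
    unfolding H_def by (rule emeasure_chain_law_measurable[OF B])
  note [measurable_cong] = sets_invariant
  have H1: "H x \<le> 1" if "x \<in> space S" for x
    using prob_space.emeasure_le_1[OF prob_space_chain_law[OF K that]] by (simp add: H_def)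
  have ne: "space \<mu> \<noteq> {}"
    using prob_space.not_empty[OF prob_space_invariant] .
  have Lm: "?L \<in> \<mu> \<rightarrow>\<^sub>M subprob_algebra (path_space S)"
    using chain_law_subprob_measurable by (simp add: measurable_cong_sets[OF sets_invariant refl])
  \<comment> \<open>The exceptional null set depends on the box and \<open>S\<close> need not be
    countably generated, so independence is not extended to \<open>B\<close> pointwise. It is first
    integrated over \<open>\<mu>\<close>, which yields an equality of two measures on path
    space.\<close>
  have m1: "emeasure (density (\<mu> \<bind> ?L) (indicator B)) X = (\<integral>\<^sup>+x. emeasure (?L x) (X \<inter> B) \<partial>\<mu>)"
    if X: "X \<in> sets (path_space S)" for X
  proof -
    have "emeasure (density (\<mu> \<bind> ?L) (indicator B)) X = (\<integral>\<^sup>+\<omega>. indicator B \<omega> * indicator X \<omega> \<partial>(\<mu> \<bind> ?L))"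
      using X B by (intro emeasure_density) (simp_all add: sets_stationary measurable_cong_sets[OF sets_stationary refl])
    also have "\<dots> = emeasure (\<mu> \<bind> ?L) (X \<inter> B)"
    proof -
      have "(\<integral>\<^sup>+\<omega>. indicator B \<omega> * indicator X \<omega> \<partial>(\<mu> \<bind> ?L)) = (\<integral>\<^sup>+\<omega>. indicator (X \<inter> B) \<omega> \<partial>(\<mu> \<bind> ?L))"
        by (intro nn_integral_cong) (simp add: indicator_inter_arith mult.commute)
      also have "\<dots> = emeasure (\<mu> \<bind> ?L) (X \<inter> B)"
        using X B by (intro nn_integral_indicator) (simp add: sets_stationary)
      finally show ?thesis .
    qed
    finally show ?thesis
      using X B by (simp add: emeasure_stationary)
  qed
  have m2: "emeasure (density \<mu> H \<bind> ?L) X = (\<integral>\<^sup>+x. H x * emeasure (?L x) X \<partial>\<mu>)"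
    if X: "X \<in> sets (path_space S)" for X
  proof -
    have "emeasure (density \<mu> H \<bind> ?L) X = (\<integral>\<^sup>+x. emeasure (?L x) X \<partial>density \<mu> H)"
      using ne Lm X by (intro emeasure_bind) simp_all
    also have "\<dots> = (\<integral>\<^sup>+x. H x * emeasure (?L x) X \<partial>\<mu>)"
      using emeasure_chain_law_measurable[OF X]
      by (intro nn_integral_density) (simp_all add: measurable_cong_sets[OF sets_invariant refl])
    finally show ?thesis .
  qed
  have "density (\<mu> \<bind> ?L) (indicator B) = density \<mu> H \<bind> ?L"
  proof (rule measure_eqI_generator_eq[OF Int_stable_prod_algebra prod_algebra_sets_into_space])
    show "emeasure (density (\<mu> \<bind> ?L) (indicator B)) X = emeasure (density \<mu> H \<bind> ?L) X"
      if X: "X \<in> prod_algebra UNIV (\<lambda>_. S)" for X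
    proof -
      from X obtain n A where A[measurable]: "\<And>i. A i \<in> sets S"
        and Xe: "X = {\<omega> \<in> space (path_space S). \<forall>i\<le>Suc n. \<omega> i \<in> A i}"
        by (rule prod_algebra_nat_box) blast
      have X: "X \<in> sets (path_space S)"
        unfolding Xe by measurable
      show ?thesis
        unfolding m1[OF X] m2[OF X]
        using shift_invariant_indep_box[of A "Suc (Suc n)", OF A] unfolding Xe H_def
        by (intro nn_integral_cong_AE) (simp only: less_Suc_eq_le)
    qed
    show "sets (density (\<mu> \<bind> ?L) (indicator B)) = sigma_sets (\<Pi>\<^sub>E i\<in>UNIV. space S) (prod_algebra UNIV (\<lambda>_. S))"
      by (simp add: sets_stationary sets_PiM)
    have "sets (density \<mu> H \<bind> ?L) = sets (path_space S)"
      using ne Lm by (intro sets_bind_measurable[of _ _ "path_space S"]) simp_all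
    then show "sets (density \<mu> H \<bind> ?L) = sigma_sets (\<Pi>\<^sub>E i\<in>UNIV. space S) (prod_algebra UNIV (\<lambda>_. S))"
      by (simp add: sets_PiM)
    show "range (\<lambda>i::nat. \<Pi>\<^sub>E i\<in>UNIV. space S) \<subseteq> prod_algebra UNIV (\<lambda>_. S)"
      using space_in_prod_algebra[of UNIV "\<lambda>_. S"] by auto
    have "space (path_space S) \<inter> B = B"
      using sets.sets_into_space[OF B] by auto
    then have "emeasure (density (\<mu> \<bind> ?L) (indicator B)) (space (path_space S)) = emeasure (\<mu> \<bind> ?L) B"
      by (simp add: m1 emeasure_stationary B)
    also have "\<dots> < top"
      using prob_space_stationary by (simp add: prob_space_def finite_measure.emeasure_finite less_top[symmetric])
    finally show "emeasure (density (\<mu> \<bind> ?L) (indicator B)) (\<Pi>\<^sub>E i\<in>UNIV. space S) \<noteq> \<infinity>"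
      by (simp add: space_PiM)
  qed auto
  \<comment> \<open>The equality of measures, obtained from cylinder sets, is used at
    \<open>B\<close> itself: this is the independence of \<open>B\<close> from itself in integrated
    form.\<close>
  from arg_cong[OF this, of "\<lambda>M. emeasure M B"]
  have *: "(\<integral>\<^sup>+x. H x \<partial>\<mu>) = (\<integral>\<^sup>+x. H x * H x \<partial>\<mu>)"
    by (simp add: m1 m2 B H_def)
  have fin: "(\<integral>\<^sup>+x. H x * H x \<partial>\<mu>) \<noteq> \<infinity>"
  proof -
    have "(\<integral>\<^sup>+x. H x \<partial>\<mu>) \<le> (\<integral>\<^sup>+x. 1 \<partial>\<mu>)"
      by (intro nn_integral_mono) (simp add: H1 space_invariant)
    then show ?thesis
      using prob_space.emeasure_space_1[OF prob_space_invariant] * by (auto simp: top_unique)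
  qed
  \<comment> \<open>Since \<open>H\<close> is at most 1, \<open>H x - H x * H x\<close> is a genuine
    difference rather than a truncated one, and its vanishing integral forces it to be 0 almost
    everywhere.\<close>
  have le: "H x * H x \<le> H x" if "x \<in> space S" for x
    using mult_left_mono[OF H1[OF that], of "H x"] by simp
  have "(\<integral>\<^sup>+x. H x - H x * H x \<partial>\<mu>) = 0"
    using fin le * by (subst nn_integral_diff) (auto simp: space_invariant)
  then have "AE x in \<mu>. H x - H x * H x = 0"
    by (subst (asm) nn_integral_0_iff_AE) simp_all
  with AE_space have "AE x in \<mu>. H x = 0 \<or> H x = 1"
  proof eventually_elim
    fix x assume "x \<in> space \<mu>" and d: "H x - H x * H x = 0"
    then have x: "x \<in> space S"
      by (simp add: space_invariant)
    obtain r where r: "0 \<le> r" "r \<le> 1" "H x = ennreal r"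
      using H1[OF x] by (cases "H x") (auto simp: top_unique)
    then have "r - r * r = 0"
      using d mult_left_le[of r r] by (simp add: ennreal_mult[symmetric] ennreal_minus ennreal_eq_0_iff)
    then show "H x = 0 \<or> H x = 1"
      using r by (auto simp: algebra_simps)
  qed
  then show ?thesis
    by (simp add: H_def)
qed

end
end
end

section \<open>Maximal ergodic inequality\<close>

text \<open>Hopf's maximal ergodic inequality for \<open>g = indicator D - c\<close>, by Garsia's argument: the
  maximum \<open>m n\<close> of the first \<open>n\<close> partial sums satisfies \<open>m (Suc n) = max 0 (g + m n \<circ> T)\<close>.\<close>

lemma maximal_ergodic_inequality:
  assumes "prob_space N" and T[measurable]: "T \<in> N \<rightarrow>\<^sub>M N" and inv: "distr N N T = N"
    and D[measurable]: "D \<in> sets N"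
  shows "c * measure N {\<omega> \<in> space N. \<exists>n. c * real n < (\<Sum>i<n. indicator D ((T ^^ i) \<omega>))} \<le> measure N D"
proof -
  interpret prob_space N by fact
  define g :: "'a \<Rightarrow> real" where "g \<omega> = indicator D \<omega> - c" for \<omega>
  define m where "m = rec_nat (\<lambda>_. 0) (\<lambda>_ f \<omega>. max 0 (g \<omega> + f (T \<omega>)))"
  have m_0: "m 0 \<omega> = 0" and m_Suc: "m (Suc n) \<omega> = max 0 (g \<omega> + m n (T \<omega>))" for n \<omega>
    by (simp_all add: m_def)
  have g_meas[measurable]: "g \<in> borel_measurable N"
    unfolding g_def by measurable
  have m_meas[measurable]: "m n \<in> borel_measurable N" for n
  proof (induction n)
    case (Suc n)
    note [measurable] = Suc
    show ?case
      unfolding m_Suc[abs_def] by measurable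
  qed (simp add: m_0[abs_def])
  have m_nonneg: "0 \<le> m n \<omega>" for n \<omega>
    by (cases n) (simp_all add: m_0 m_Suc)
  have m_mono: "m n \<omega> \<le> m (Suc n) \<omega>" for n \<omega>
  proof (induction n arbitrary: \<omega>)
    case (Suc n)
    show ?case
      using Suc[of "T \<omega>"] unfolding m_Suc[of "Suc n"] m_Suc[of n \<omega>] by simp
  qed (simp add: m_0 m_nonneg)
  have m_bound: "m n \<omega> \<le> real n * (1 + \<bar>c\<bar>)" for n \<omega>
  proof (induction n arbitrary: \<omega>)
    case (Suc n)
    have "g \<omega> \<le> 1 + \<bar>c\<bar>"
      by (auto simp: g_def indicator_def)
    then show ?case
      using Suc[of "T \<omega>"] by (auto simp: m_Suc algebra_simps)
  qed (simp add: m_0)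
  have m_int: "integrable N (m n)" for n
    by (rule integrable_const_bound[where B="real n * (1 + \<bar>c\<bar>)"]) (auto simp: m_nonneg m_bound)
  have g_int: "integrable N g"
    by (rule integrable_const_bound[where B="1 + \<bar>c\<bar>"]) (auto simp: g_def indicator_def)
  define U where "U n = {\<omega> \<in> space N. 0 < m n \<omega>}" for n
  have U[measurable]: "U n \<in> sets N" for n
    unfolding U_def by measurable
  have mT: "integrable N (\<lambda>\<omega>. m n (T \<omega>))" "(\<integral>\<omega>. m n (T \<omega>) \<partial>N) = (\<integral>\<omega>. m n \<omega> \<partial>N)" for n
    using integrable_distr_eq[OF T m_meas] integral_distr[OF T m_meas] m_int by (auto simp: inv)
  have fin: "c * measure N (U n) \<le> measure N D" for n
  proof (cases n)
    case 0
    then show ?thesis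
      by (simp add: U_def m_0)
  next
    case (Suc k)
    \<comment> \<open>Monotonicity of \<open>m\<close> makes the difference nonnegative, and
      invariance of \<open>N\<close> allows \<open>m k\<close> to be composed with
      \<open>T\<close>.\<close>
    have "0 \<le> (\<integral>\<omega>. m (Suc k) \<omega> \<partial>N) - (\<integral>\<omega>. m k \<omega> \<partial>N)"
      by (simp add: integral_mono m_int m_mono)
    also have "\<dots> = (\<integral>\<omega>. m (Suc k) \<omega> - m k (T \<omega>) \<partial>N)"
      by (simp add: mT m_int)
    \<comment> \<open>On \<open>U n\<close> the maximum defining \<open>m (Suc k)\<close> is its
      second argument, so the difference is exactly \<open>g\<close>; elsewhere
      \<open>m (Suc k)\<close> is 0 and the difference is nonpositive.\<close>
    also have "\<dots> \<le> (\<integral>\<omega>. indicator (U n) \<omega> * g \<omega> \<partial>N)"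
    proof (rule integral_mono)
      show "integrable N (\<lambda>\<omega>. indicator (U n) \<omega> * g \<omega>)"
        using integrable_mult_indicator[OF U g_int] by simp
      show "m (Suc k) \<omega> - m k (T \<omega>) \<le> indicator (U n) \<omega> * g \<omega>" if "\<omega> \<in> space N" for \<omega>
        using that m_nonneg[of k "T \<omega>"] by (auto simp: U_def Suc m_Suc indicator_def)
    qed (simp add: mT m_int)
    also have "\<dots> = (\<integral>\<omega>. indicator (U n \<inter> D) \<omega> - c * indicator (U n) \<omega> \<partial>N)"
      by (intro Bochner_Integration.integral_cong) (auto simp: g_def indicator_def)
    also have "\<dots> = measure N (U n \<inter> D) - c * measure N (U n)"
      by (simp add: finite_measure.emeasure_finite less_top[symmetric])
    finally show ?thesis
      using finite_measure_mono[of "U n \<inter> D" D] by simp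
  qed
  have sum_le: "(\<Sum>i<n. g ((T ^^ i) \<omega>)) \<le> m n \<omega>" for n \<omega>
  proof (induction n arbitrary: \<omega>)
    case (Suc n)
    have "(\<Sum>i<Suc n. g ((T ^^ i) \<omega>)) = g \<omega> + (\<Sum>i<n. g ((T ^^ i) (T \<omega>)))"
      by (simp only: sum.lessThan_Suc_shift funpow_Suc_right) simp
    then show ?case
      using Suc[of "T \<omega>"] by (simp add: m_Suc)
  qed (simp add: m_0)
  have "incseq U"
    unfolding U_def by (intro incseq_SucI) (auto intro: less_le_trans m_mono)
  then have "(\<lambda>n. measure N (U n)) \<longlonglongrightarrow> measure N (\<Union>n. U n)"
    by (intro finite_Lim_measure_incseq) auto
  then have le: "c * measure N (\<Union>n. U n) \<le> measure N D"
    by (intro LIMSEQ_le_const2[OF tendsto_mult_left]) (auto intro: fin)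
  show ?thesis
  \<comment> \<open>For nonpositive \<open>c\<close> the left side is nonpositive; in the other case
    multiplication by \<open>c\<close> preserves the comparison of measures.\<close>
  proof (cases "c \<le> 0")
    case True
    then show ?thesis
      by (meson measure_nonneg mult_nonpos_nonneg order_trans)
  next
    case False
    have "\<omega> \<in> (\<Union>n. U n)" if "\<omega> \<in> space N" "c * real n < (\<Sum>i<n. indicator D ((T ^^ i) \<omega>))" for \<omega> n
    proof (rule UN_I[OF UNIV_I])
      have "(\<Sum>i<n. g ((T ^^ i) \<omega>)) \<le> m n \<omega>"
        by (rule sum_le)
      with that show "\<omega> \<in> U n"
        by (simp add: U_def g_def sum_subtractf mult.commute)
    qed
    then have "measure N {\<omega> \<in> space N. \<exists>n. c * real n < (\<Sum>i<n. indicator D ((T ^^ i) \<omega>))} \<le> measure N (\<Union>n. U n)"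
      by (intro finite_measure_mono) auto
    then show ?thesis
      using False le by (meson linorder_le_cases mult_left_mono order_trans)
  qed
qed

text \<open>A substitute for \<open>{limsup > c}\<close>: demanding an unbounded excess makes shift-invariance
  immediate, and on the complement the upper density of the visits to \<open>D\<close> is still at most \<open>c\<close>.\<close>

definition excess :: "'a measure \<Rightarrow> real \<Rightarrow> 'a set \<Rightarrow> (nat \<Rightarrow> 'a) set" where
  "excess S c D = {\<omega> \<in> space (path_space S). \<forall>C::nat. \<exists>n. real C + c * real n < (\<Sum>i<n. indicator D (\<omega> i))}"

lemma sets_excess:
  assumes [measurable]: "D \<in> sets S"
  shows "excess S c D \<in> sets (path_space S)"
  unfolding excess_def by measurable

text \<open>Deleting the first coordinate changes the number of visits by at most one and the time
  by one. This is a bounded change, absorbed by quantifying over every \<open>C\<close>.\<close>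

lemma shift_excess:
  assumes "0 \<le> c" and \<omega>: "\<omega> \<in> space (path_space S)"
  shows "(\<lambda>n. \<omega> (Suc n)) \<in> excess S c D \<longleftrightarrow> \<omega> \<in> excess S c D"
proof -
  define s :: "(nat \<Rightarrow> 'a) \<Rightarrow> nat \<Rightarrow> real" where "s \<omega> n = (\<Sum>i<n. indicator D (\<omega> i))" for \<omega> n
  have s_0: "s \<omega> 0 = 0" and s_Suc: "s \<omega> (Suc n) = indicator D (\<omega> 0) + s (\<lambda>n. \<omega> (Suc n)) n" for n
    by (simp_all add: s_def sum.lessThan_Suc_shift del: sum.lessThan_Suc)
  have "(\<forall>C::nat. \<exists>n. real C + c * real n < s (\<lambda>n. \<omega> (Suc n)) n) \<longleftrightarrow> (\<forall>C::nat. \<exists>n. real C + c * real n < s \<omega> n)"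
  proof (intro iffI allI)
    fix C :: nat
    assume "\<forall>C::nat. \<exists>n. real C + c * real n < s (\<lambda>n. \<omega> (Suc n)) n"
    \<comment> \<open>The surplus \<open>nat \<lceil>c\<rceil>\<close> pays for the additional
      \<open>c\<close> that appears when n becomes \<open>Suc n\<close>.\<close>
    then obtain n where "real (C + nat \<lceil>c\<rceil>) + c * real n < s (\<lambda>n. \<omega> (Suc n)) n"
      by blast
    moreover have "c \<le> real (nat \<lceil>c\<rceil>)"
      by (rule real_nat_ceiling_ge)
    ultimately have "real C + c * real (Suc n) < s \<omega> (Suc n)"
      unfolding s_Suc by (simp add: algebra_simps indicator_def)
    then show "\<exists>n. real C + c * real n < s \<omega> n" ..
  next
    fix C :: nat
    assume "\<forall>C::nat. \<exists>n. real C + c * real n < s \<omega> n"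
    \<comment> \<open>The surplus of one pays for a possible visit at time 0, and it rules out n =
      0, where the sum is empty.\<close>
    then obtain n where n: "real (Suc C) + c * real n < s \<omega> n"
      by blast
    then obtain k where k: "n = Suc k"
      using assms by (cases n) (auto simp: s_0)
    moreover have "indicator D (\<omega> 0) \<le> (1 :: real)"
      by (simp add: indicator_def)
    ultimately have "real C + c * real k < s (\<lambda>n. \<omega> (Suc n)) k"
      using n assms(1) unfolding k s_Suc by (simp only: of_nat_Suc distrib_left)
    then show "\<exists>n. real C + c * real n < s (\<lambda>n. \<omega> (Suc n)) n" ..
  qed
  then show ?thesis
    using \<omega> measurable_space[OF shift_measurable \<omega>] by (simp add: excess_def s_def)
qed

text \<open>By the zero-one law the probability of the excess event is almost everywhere the
  indicator of the set on the left, whose mass is therefore the stationary probability of that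
  event. The maximal ergodic inequality for the shift bounds the latter.\<close>

lemma measure_excess_le:
  assumes K: "markov_kernel S K" and inv: "invariant_prob S K \<mu>" and D: "D \<in> sets S" and c: "0 \<le> c"
  shows "c * measure \<mu> {x \<in> space S. emeasure (chain_law S K x) (excess S c D) \<noteq> 0} \<le> measure \<mu> D"
proof -
  let ?L = "chain_law S K" and ?B = "excess S c D"
  let ?N = "\<mu> \<bind> ?L" and ?T = "\<lambda>(\<omega> :: nat \<Rightarrow> 'a) n. \<omega> (Suc n)"
  let ?Z = "{x \<in> space S. emeasure (?L x) ?B \<noteq> 0}"
  define D' where "D' = {\<omega> \<in> space (path_space S). \<omega> 0 \<in> D}"
  interpret \<mu>: prob_space \<mu>
    by (rule prob_space_invariant[OF K inv])
  interpret N: prob_space ?N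
    by (rule prob_space_stationary[OF K inv])
  note sets_N = sets_stationary[OF K inv] and space_N = space_stationary[OF K inv]
  note sets_\<mu> = sets_invariant[OF K inv] and space_\<mu> = space_invariant[OF K inv]
  have [measurable]: "D' \<in> sets (path_space S)"
    unfolding D'_def using D by measurable
  have Z: "?Z \<in> sets S"
    using emeasure_chain_law_measurable[OF K sets_excess[OF D, of c]] by measurable
  have zo: "AE x in \<mu>. emeasure (?L x) ?B = indicator ?Z x"
  proof -
    have "AE x in \<mu>. emeasure (?L x) ?B = 0 \<or> emeasure (?L x) ?B = 1"
      by (rule shift_invariant_zero_one[OF K inv sets_excess[OF D]]) (rule shift_excess[OF c])
    with AE_space show ?thesis
      by eventually_elim (auto simp: space_\<mu> indicator_def)
  qed
  have "emeasure \<mu> ?Z = (\<integral>\<^sup>+x. indicator ?Z x \<partial>\<mu>)"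
    using Z by (simp add: sets_\<mu>)
  also have "\<dots> = (\<integral>\<^sup>+x. emeasure (?L x) ?B \<partial>\<mu>)"
  proof (rule nn_integral_cong_AE)
    from zo show "AE x in \<mu>. indicator ?Z x = emeasure (?L x) ?B"
      by eventually_elim (rule sym)
  qed
  also have "\<dots> = emeasure ?N ?B"
    by (rule emeasure_stationary[OF K inv sets_excess[OF D], symmetric])
  finally have Z_eq: "measure \<mu> ?Z = measure ?N ?B"
    by (simp add: measure_def)
  have "emeasure ?N D' = (\<integral>\<^sup>+x. emeasure (?L x) D' \<partial>\<mu>)"
    by (rule emeasure_stationary[OF K inv]) measurable
  also have "\<dots> = (\<integral>\<^sup>+x. indicator D x \<partial>\<mu>)"
  proof (rule nn_integral_cong)
    fix x assume "x \<in> space \<mu>"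
    then have x: "x \<in> space S"
      by (simp add: space_\<mu>)
    have "emeasure (?L x) D' = (\<integral>\<^sup>+\<omega>. indicator D' \<omega> \<partial>?L x)"
      by (rule nn_integral_indicator[symmetric]) (simp add: sets_chain_law[OF K x])
    also have "\<dots> = (\<integral>\<^sup>+\<omega>. indicator D (\<omega> 0) \<partial>?L x)"
      by (intro nn_integral_cong) (auto simp: D'_def indicator_def space_chain_law[OF K x])
    also have "\<dots> = indicator D x"
      by (intro nn_integral_chain_law_0[OF K x] borel_measurable_indicator D)
    finally show "emeasure (?L x) D' = indicator D x" .
  qed
  also have "\<dots> = emeasure \<mu> D"
    using D by (simp add: sets_\<mu>)
  finally have D_eq: "measure ?N D' = measure \<mu> D"
    by (simp add: measure_def)
  have T: "?T \<in> ?N \<rightarrow>\<^sub>M ?N"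
    using shift_measurable by (simp add: measurable_cong_sets[OF sets_N sets_N])
  have iter: "(?T ^^ i) \<omega> = (\<lambda>n. \<omega> (n + i))" for i \<omega>
    by (induction i) auto
  have ind: "indicator D' ((?T ^^ i) \<omega>) = (indicator D (\<omega> i) :: real)" if "\<omega> \<in> space (path_space S)" for i \<omega>
    using that by (auto simp: iter D'_def indicator_def space_PiM PiE_iff)
  \<comment> \<open>Taking \<open>C = 0\<close> embeds the excess event into the event of the
    maximal inequality for \<open>D'\<close>.\<close>
  have "c * measure ?N ?B \<le> c * measure ?N {\<omega> \<in> space ?N. \<exists>n. c * real n < (\<Sum>i<n. indicator D' ((?T ^^ i) \<omega>))}"
  proof (intro mult_left_mono N.finite_measure_mono c subsetI)
    show "\<omega> \<in> {\<omega> \<in> space ?N. \<exists>n. c * real n < (\<Sum>i<n. indicator D' ((?T ^^ i) \<omega>))}" if "\<omega> \<in> ?B" for \<omega>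
    proof -
      from that have \<omega>: "\<omega> \<in> space (path_space S)"
        and "\<exists>n. real 0 + c * real n < (\<Sum>i<n. indicator D (\<omega> i))"
        unfolding excess_def by blast+
      then show ?thesis
        by (simp add: ind space_N)
    qed
    have "{\<omega> \<in> space ?N. \<exists>n. c * real n < (\<Sum>i<n. indicator D' ((?T ^^ i) \<omega>))} =
        {\<omega> \<in> space (path_space S). \<exists>n. c * real n < (\<Sum>i<n. indicator D (\<omega> i))}"
      by (auto simp: ind space_N cong: conj_cong)
    also have "\<dots> \<in> sets (path_space S)"
      using D by measurable
    finally show "{\<omega> \<in> space ?N. \<exists>n. c * real n < (\<Sum>i<n. indicator D' ((?T ^^ i) \<omega>))} \<in> sets ?N"
      by (simp only: sets_N)
  qed
  also have "\<dots> \<le> measure ?N D'"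
    by (rule maximal_ergodic_inequality[OF N.prob_space_axioms T distr_shift_stationary[OF K inv]])
       (simp add: sets_N)
  finally show ?thesis
    by (simp add: Z_eq D_eq)
qed

section \<open>Mutually singular invariant measures\<close>

text \<open>The inequality for the complement and the equality of total masses give the reverse
  inequality; finiteness allows the cancellation.\<close>

lemma measure_eqI_le:
  assumes "finite_measure M" "sets M = sets N" "emeasure M (space M) = emeasure N (space N)"
    and le: "\<And>X. X \<in> sets M \<Longrightarrow> emeasure M X \<le> emeasure N X"
  shows "M = N"
proof (rule measure_eqI)
  interpret finite_measure M by fact
  fix X assume X: "X \<in> sets M"
  have sp: "space M = space N"
    using assms(2) by (rule sets_eq_imp_space_eq)
  have "emeasure N X + emeasure M (space M - X) \<le> emeasure N X + emeasure N (space M - X)"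
    using X by (intro add_left_mono le) auto
  also have "\<dots> = emeasure N (space N)"
    using X assms(2) sets.sets_into_space[OF X]
    by (subst plus_emeasure) (auto simp: sp intro!: arg_cong[of _ _ "emeasure N"])
  also have "\<dots> = emeasure M X + emeasure M (space M - X)"
    using X sets.sets_into_space[OF X] unfolding assms(3)[symmetric]
    by (subst plus_emeasure) (auto intro!: arg_cong[of _ _ "emeasure M"])
  finally have "emeasure N X \<le> emeasure M X"
    using emeasure_finite[of "space M - X"] by (simp add: add.commute[of _ "emeasure M (space M - X)"])
  then show "emeasure M X = emeasure N X"
    using le[OF X] by (rule antisym[rotated])
qed (rule assms)

text \<open>Subtraction in \<open>ennreal\<close> is truncated, so \<open>f1 - f2\<close> is the
  density of the positive part of the difference. Restricting to the set where it is positive shows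
  that the kernel can only increase this measure; as the kernel preserves total mass, the measure is
  invariant. The constant \<open>c\<close> is its mass.\<close>

lemma invariant_prob_positive_part:
  assumes K: "markov_kernel S K" and sets: "sets \<tau> = sets S"
    and f[measurable]: "f1 \<in> borel_measurable S" "f2 \<in> borel_measurable S"
    and inv: "invariant_prob S K (density \<tau> f1)" "invariant_prob S K (density \<tau> f2)"
    and neq: "density \<tau> f1 \<noteq> density \<tau> f2"
  obtains c where "invariant_prob S K (density \<tau> (\<lambda>x. (f1 x - f2 x) / c))"
proof -
  note [measurable_cong] = sets
  have sp: "space \<tau> = space S"
    using sets by (rule sets_eq_imp_space_eq)
  have emK[measurable]: "(\<lambda>x. emeasure (K x) X) \<in> borel_measurable S" if "X \<in> sets S" for X
    using measurable_emeasure_subprob_algebra[OF that] markov_kernel_measurable[OF K]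
    by (rule measurable_compose[rotated])
  define g where "g x = f1 x - f2 x" for x
  have [measurable]: "g \<in> borel_measurable S"
    unfolding g_def by measurable
  define A where "A = {x \<in> space S. f2 x < f1 x}"
  have A[measurable]: "A \<in> sets S"
    unfolding A_def by measurable
  define c where "c = (\<integral>\<^sup>+x. g x \<partial>\<tau>)"
  interpret \<mu>1: prob_space "density \<tau> f1"
    using inv by (simp add: invariant_prob_def)
  interpret \<mu>2: prob_space "density \<tau> f2"
    using inv by (simp add: invariant_prob_def)
  have one: "(\<integral>\<^sup>+x. f1 x \<partial>\<tau>) = 1"
    using \<mu>1.emeasure_space_1 by (subst (asm) emeasure_density) (simp_all add: sp cong: nn_integral_cong_simp)
  have g_le: "g x \<le> f1 x" for x
    by (simp add: g_def diff_le_self_ennreal)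
  have le_g: "f1 x \<le> g x + f2 x" for x
    by (auto simp: g_def diff_add_self_ennreal)
  \<comment> \<open>Infinity minus infinity is infinity in \<open>ennreal\<close>, so off the set
    \<open>A\<close> the difference vanishes only where \<open>f1\<close> is finite.\<close>
  have AE_fin: "AE x in \<tau>. f1 x \<noteq> \<infinity>"
    using one by (intro nn_integral_noteq_infinite) simp_all
  have c_le: "c \<le> 1"
    unfolding c_def one[symmetric] by (intro nn_integral_mono g_le)
  have invK: "(\<integral>\<^sup>+x. f x * emeasure (K x) X \<partial>\<tau>) = emeasure (density \<tau> f) X"
    if "invariant_prob S K (density \<tau> f)" "f \<in> borel_measurable S" "X \<in> sets S" for f X
    using that unfolding invariant_prob_iff[OF K] by (simp add: nn_integral_density)
  have gK: "emeasure (density \<tau> g) X \<le> (\<integral>\<^sup>+x. g x * emeasure (K x) X \<partial>\<tau>)" if X[measurable]: "X \<in> sets S" for X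
  proof -
    have "emeasure (density \<tau> g) X + emeasure (density \<tau> f2) (X \<inter> A) =
        (\<integral>\<^sup>+x. g x * indicator X x + f2 x * indicator (X \<inter> A) x \<partial>\<tau>)"
      by (simp add: emeasure_density nn_integral_add)
    also have "\<dots> = (\<integral>\<^sup>+x. f1 x * indicator (X \<inter> A) x \<partial>\<tau>)"
      using AE_fin AE_space
    proof (intro nn_integral_cong_AE, eventually_elim)
      fix x assume "f1 x \<noteq> \<infinity>" "x \<in> space \<tau>"
      then show "g x * indicator X x + f2 x * indicator (X \<inter> A) x = f1 x * indicator (X \<inter> A) x"
        by (auto simp: indicator_def g_def A_def sp diff_add_self_ennreal diff_eq_0_iff_ennreal less_top)
    qed
    also have "\<dots> = emeasure (density \<tau> f1) (X \<inter> A)"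
      by (simp add: emeasure_density)
    also have "\<dots> = (\<integral>\<^sup>+x. f1 x * emeasure (K x) (X \<inter> A) \<partial>\<tau>)"
      by (simp add: invK inv)
    \<comment> \<open>Here \<open>f1\<close> is at most \<open>g + f2\<close>, and
      \<open>X \<inter> A\<close> is enlarged to \<open>X\<close> in the term with \<open>g\<close>
      only. By invariance the term with \<open>f2\<close> then cancels.\<close>
    also have "\<dots> \<le> (\<integral>\<^sup>+x. g x * emeasure (K x) X + f2 x * emeasure (K x) (X \<inter> A) \<partial>\<tau>)"
    proof (rule nn_integral_mono)
      fix x assume "x \<in> space \<tau>"
      then have "emeasure (K x) (X \<inter> A) \<le> emeasure (K x) X"
        using K by (intro emeasure_mono) (auto simp: sp markov_kernel_iff)
      then have "(g x + f2 x) * emeasure (K x) (X \<inter> A) \<le> g x * emeasure (K x) X + f2 x * emeasure (K x) (X \<inter> A)"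
        unfolding distrib_right by (intro add_right_mono mult_left_mono) auto
      then show "f1 x * emeasure (K x) (X \<inter> A) \<le> g x * emeasure (K x) X + f2 x * emeasure (K x) (X \<inter> A)"
        using le_g[of x] by (meson mult_right_mono order_trans zero_le)
    qed
    also have "\<dots> = (\<integral>\<^sup>+x. g x * emeasure (K x) X \<partial>\<tau>) + (\<integral>\<^sup>+x. f2 x * emeasure (K x) (X \<inter> A) \<partial>\<tau>)"
      by (rule nn_integral_add) simp_all
    also have "(\<integral>\<^sup>+x. f2 x * emeasure (K x) (X \<inter> A) \<partial>\<tau>) = emeasure (density \<tau> f2) (X \<inter> A)"
      by (simp add: invK inv)
    finally show ?thesis
      using \<mu>2.emeasure_finite[of "X \<inter> A"]
      by (simp add: add.commute[of _ "emeasure (density \<tau> f2) (X \<inter> A)"])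
  qed
  have g_fin: "finite_measure (density \<tau> g)"
    using c_le by (intro finite_measureI) (auto simp: emeasure_density c_def sp top_unique cong: nn_integral_cong_simp)
  have ne: "space \<tau> \<noteq> {}"
    using \<mu>1.not_empty by simp
  have Km: "K \<in> density \<tau> g \<rightarrow>\<^sub>M subprob_algebra S"
    using markov_kernel_measurable[OF K] by (simp add: measurable_cong_sets[OF sets refl])
  have bind: "emeasure (density \<tau> g \<bind> K) X = (\<integral>\<^sup>+x. g x * emeasure (K x) X \<partial>\<tau>)" if "X \<in> sets S" for X
    using ne Km that by (simp add: emeasure_bind nn_integral_density)
  have sets_bind: "sets (density \<tau> g \<bind> K) = sets S"
    using Km ne by (simp add: sets_bind_measurable)
  have "density \<tau> g = density \<tau> g \<bind> K"
  proof (rule measure_eqI_le[OF g_fin])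
    show "emeasure (density \<tau> g) (space (density \<tau> g)) = emeasure (density \<tau> g \<bind> K) (space (density \<tau> g \<bind> K))"
    proof -
      have "emeasure (K x) (space S) = 1" if "x \<in> space S" for x
        using K that prob_space.emeasure_space_1[of "K x"] space_markov_kernel[OF K that] by (auto simp: markov_kernel_iff)
      then show ?thesis
        by (simp add: bind sets_eq_imp_space_eq[OF sets_bind] emeasure_density sp cong: nn_integral_cong_simp)
    qed
  qed (simp_all add: sets sets_bind bind gK)
  then have gK_eq: "emeasure (density \<tau> g) X = (\<integral>\<^sup>+x. g x * emeasure (K x) X \<partial>\<tau>)" if "X \<in> sets S" for X
    using bind[OF that] by simp
  \<comment> \<open>If the positive part vanished, one invariant measure would lie below the other,
    and two probability measures ordered in this way coincide.\<close>
  have "c \<noteq> 0"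
  proof
    assume "c = 0"
    then have "AE x in \<tau>. g x = 0"
      unfolding c_def by (subst (asm) nn_integral_0_iff_AE) simp_all
    then have le: "AE x in \<tau>. f1 x \<le> f2 x"
      by eventually_elim (simp add: g_def diff_eq_0_iff_ennreal)
    have "density \<tau> f1 = density \<tau> f2"
    proof (rule measure_eqI_le[OF \<mu>1.finite_measure_axioms])
      show "emeasure (density \<tau> f1) X \<le> emeasure (density \<tau> f2) X" if "X \<in> sets (density \<tau> f1)" for X
      proof -
        from that have [measurable]: "X \<in> sets S"
          by (simp add: sets)
        have "AE x in \<tau>. f1 x * indicator X x \<le> f2 x * indicator X x"
          using le by eventually_elim (simp add: mult_right_mono)
        then show ?thesis
          by (simp add: emeasure_density nn_integral_mono_AE)
      qed
      show "emeasure (density \<tau> f1) (space (density \<tau> f1)) = emeasure (density \<tau> f2) (space (density \<tau> f2))"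
        by (simp only: \<mu>1.emeasure_space_1 \<mu>2.emeasure_space_1)
    qed simp
    with neq show False ..
  qed
  have c_top: "c \<noteq> top"
    using c_le by (auto simp: top_unique)
  have "invariant_prob S K (density \<tau> (\<lambda>x. g x / c))"
    unfolding invariant_prob_iff[OF K]
  proof (intro conjI ballI)
    show "prob_space (density \<tau> (\<lambda>x. g x / c))"
      using \<open>c \<noteq> 0\<close> c_top
      by (intro prob_spaceI) (simp add: emeasure_density nn_integral_divide c_def[symmetric] ennreal_divide_self less_top cong: nn_integral_cong_simp)
    fix X assume X[measurable]: "X \<in> sets S"
    have "(\<integral>\<^sup>+x. emeasure (K x) X \<partial>density \<tau> (\<lambda>x. g x / c)) = (\<integral>\<^sup>+x. g x * emeasure (K x) X \<partial>\<tau>) / c"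
      by (simp add: nn_integral_density nn_integral_divide[symmetric] ennreal_divide_times ennreal_times_divide)
    also have "\<dots> = emeasure (density \<tau> g) X / c"
      by (simp add: gK_eq)
    also have "\<dots> = emeasure (density \<tau> (\<lambda>x. g x / c)) X"
      by (simp add: emeasure_density nn_integral_divide[symmetric] ennreal_divide_times ennreal_times_divide)
    finally show "(\<integral>\<^sup>+x. emeasure (K x) X \<partial>density \<tau> (\<lambda>x. g x / c)) = emeasure (density \<tau> (\<lambda>x. g x / c)) X" .
  qed (simp add: sets)
  then show thesis
    unfolding g_def by (rule that)
qed

text \<open>Both measures have densities, \<open>f1\<close> and \<open>f2\<close>, with respect to
  their supremum. The normalised positive parts of \<open>f1 - f2\<close> and \<open>f2 - f1\<close>
  are invariant and live on \<open>A\<close>, where \<open>f2 < f1\<close>, and on its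
  complement.\<close>

lemma mutually_singular_invariant:
  assumes K: "markov_kernel S K" and inv: "invariant_prob S K \<mu>1" "invariant_prob S K \<mu>2" and neq: "\<mu>1 \<noteq> \<mu>2"
  obtains \<mu> \<nu> A where "invariant_prob S K \<mu>" "invariant_prob S K \<nu>" "A \<in> sets S"
    "emeasure \<mu> (space S - A) = 0" "emeasure \<nu> A = 0"
proof -
  let ?\<tau> = "sup_measure' \<mu>1 \<mu>2"
  interpret \<mu>1: prob_space \<mu>1
    using inv by (simp add: invariant_prob_def)
  interpret \<mu>2: prob_space \<mu>2
    using inv by (simp add: invariant_prob_def)
  have sets: "sets \<mu>1 = sets S" "sets \<mu>2 = sets S"
    using inv by (auto simp: invariant_prob_def)
  then have sets_\<tau>: "sets ?\<tau> = sets S"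
    by simp
  then have sp: "space ?\<tau> = space S"
    by (rule sets_eq_imp_space_eq)
  interpret \<tau>: finite_measure ?\<tau>
  proof
    have "emeasure \<mu>1 X + emeasure \<mu>2 Y \<le> 2" for X Y
      using add_mono[OF \<mu>1.emeasure_le_1[of X] \<mu>2.emeasure_le_1[of Y]] by simp
    then have "emeasure ?\<tau> (space ?\<tau>) \<le> 2"
      using sets sets_eq_imp_space_eq[OF sets(1)]
      by (subst emeasure_sup_measure')
         (auto simp: sp intro!: SUP_least)
    then show "emeasure ?\<tau> (space ?\<tau>) \<noteq> \<infinity>"
      by (auto simp: top_unique)
  qed
  have "absolutely_continuous ?\<tau> \<mu>1"
    using sets le_emeasure_sup_measure'1[of \<mu>2 \<mu>1]
    by (auto simp: absolutely_continuous_def null_sets_def) (metis le_zero_eq)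
  from \<tau>.Radon_Nikodym[OF this] sets sets_\<tau> obtain f1 where
    f1: "f1 \<in> borel_measurable ?\<tau>" "density ?\<tau> f1 = \<mu>1"
    by auto
  have "absolutely_continuous ?\<tau> \<mu>2"
    using sets le_emeasure_sup_measure'2[of \<mu>2 \<mu>1]
    by (auto simp: absolutely_continuous_def null_sets_def) (metis le_zero_eq)
  from \<tau>.Radon_Nikodym[OF this] sets sets_\<tau> obtain f2 where
    f2: "f2 \<in> borel_measurable ?\<tau>" "density ?\<tau> f2 = \<mu>2"
    by auto
  have [measurable]: "f1 \<in> borel_measurable S" "f2 \<in> borel_measurable S"
    using f1 f2 by (simp_all add: measurable_cong_sets[OF sets_\<tau> refl])
  note [measurable_cong] = sets_\<tau>
  obtain c where c: "invariant_prob S K (density ?\<tau> (\<lambda>x. (f1 x - f2 x) / c))"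
    using invariant_prob_positive_part[OF K sets_\<tau>, of f1 f2] inv neq f1 f2 by auto
  obtain d where d: "invariant_prob S K (density ?\<tau> (\<lambda>x. (f2 x - f1 x) / d))"
    using invariant_prob_positive_part[OF K sets_\<tau>, of f2 f1] inv neq f1 f2 by auto
  define A where "A = {x \<in> space S. f2 x < f1 x}"
  have fin: "AE x in ?\<tau>. f x \<noteq> \<infinity>"
    if f: "f \<in> borel_measurable ?\<tau>" and "prob_space (density ?\<tau> f)" for f
  proof -
    have "emeasure (density ?\<tau> f) (space ?\<tau>) = 1"
      using prob_space.emeasure_space_1[OF that(2)] by simp
    then have "(\<integral>\<^sup>+x. f x \<partial>?\<tau>) = 1"
      by (subst (asm) emeasure_density[OF f]) (simp_all cong: nn_integral_cong_simp)
    then show ?thesis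
      by (intro nn_integral_noteq_infinite f) simp
  qed
  have fin1: "AE x in ?\<tau>. f1 x \<noteq> \<infinity>"
    using f1 \<mu>1.prob_space_axioms by (intro fin) simp_all
  have fin2: "AE x in ?\<tau>. f2 x \<noteq> \<infinity>"
    using f2 \<mu>2.prob_space_axioms by (intro fin) simp_all
  have [measurable]: "A \<in> sets S"
    unfolding A_def by measurable
  show thesis
  proof (rule that[OF c d])
    show "emeasure (density ?\<tau> (\<lambda>x. (f1 x - f2 x) / c)) (space S - A) = 0"
    proof -
      have "AE x in ?\<tau>. (f1 x - f2 x) / c * indicator (space S - A) x = 0"
        using fin1 by eventually_elim (auto simp: indicator_def A_def diff_eq_0_iff_ennreal less_top)
      then show ?thesis
        by (simp add: emeasure_density nn_integral_0_iff_AE)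
    qed
    show "emeasure (density ?\<tau> (\<lambda>x. (f2 x - f1 x) / d)) A = 0"
    proof -
      have "AE x in ?\<tau>. (f2 x - f1 x) / d * indicator A x = 0"
        using fin2 by eventually_elim (auto simp: indicator_def A_def diff_eq_0_iff_ennreal less_top)
      then show ?thesis
        by (simp add: emeasure_density nn_integral_0_iff_AE)
    qed
  qed simp
qed

section \<open>Separation of mutually singular measures\<close>

lemma (in finite_measure) measure_Union_le_geometric:
  assumes B: "\<And>i::nat. B i \<in> sets M" and le: "\<And>i. measure M (B i) \<le> e * (1 / 2) ^ Suc i"
  shows "measure M (\<Union>i. B i) \<le> e"
proof -
  have e: "(\<lambda>i. e * (1 / 2) ^ Suc i) sums e"
    using sums_mult[OF power_half_series, of e] by simp
  have summable: "summable (\<lambda>i. measure M (B i))"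
    using le by (intro summable_comparison_test'[OF sums_summable[OF e], of 0]) simp
  have "measure M (\<Union>i. B i) \<le> (\<Sum>i. measure M (B i))"
    using B summable by (intro finite_measure_subadditive_countably) auto
  also have "\<dots> \<le> (\<Sum>i. e * (1 / 2) ^ Suc i)"
    by (intro suminf_le le summable sums_summable[OF e])
  also have "\<dots> = e"
    using e by (simp add: sums_iff)
  finally show ?thesis .
qed

lemma (in finite_measure) incseq_Union_approx:
  assumes A: "\<And>n. A n \<in> sets M" "incseq A" and "0 < e"
  obtains n where "measure M ((\<Union>n. A n) - A n) \<le> e"
proof -
  have "(\<lambda>n. measure M (A n)) \<longlonglongrightarrow> measure M (\<Union>n. A n)"
    using A by (intro finite_Lim_measure_incseq) auto
  then obtain n where "\<bar>measure M (A n) - measure M (\<Union>n. A n)\<bar> < e"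
    using \<open>0 < e\<close> LIMSEQ_iff[THEN iffD1] by (metis order_refl real_norm_def)
  moreover have "measure M ((\<Union>n. A n) - A n) = measure M (\<Union>n. A n) - measure M (A n)"
    using A by (intro finite_measure_Diff) auto
  ultimately show thesis
    by (intro that[of n]) simp
qed

section \<open>Inner regularity of finite Borel measures on metric spaces\<close>

lemma closed_infdist_ge: "closed {x. c \<le> infdist x S}"
  by (intro closed_Collect_le continuous_intros)

text \<open>Exhausts an open set from inside by closed sets. The distance to the empty set is 0 by
  convention, hence the assumption \<open>S \<noteq> {}\<close>.\<close>

lemma infdist_ge_UN:
  assumes "closed S" "S \<noteq> {}"
  shows "(\<Union>n. {x. 1 / real (Suc n) \<le> infdist x S}) = - S"
proof (intro set_eqI iffI)
  fix x assume "x \<in> (\<Union>n. {x. 1 / real (Suc n) \<le> infdist x S})"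
  then obtain n where "1 / real (Suc n) \<le> infdist x S"
    by blast
  moreover have "0 < 1 / real (Suc n)"
    by simp
  ultimately have "infdist x S \<noteq> 0"
    by linarith
  then show "x \<in> - S"
    by auto
next
  fix x assume "x \<in> - S"
  then have "0 < infdist x S"
    using infdist_pos_not_in_closed[OF assms] by simp
  then obtain n where "inverse (real (Suc n)) < infdist x S"
    using reals_Archimedean by blast
  then show "x \<in> (\<Union>n. {x. 1 / real (Suc n) \<le> infdist x S})"
    by (auto simp: inverse_eq_divide intro!: exI[of _ n])
qed

lemma incseq_infdist_ge: "incseq (\<lambda>n. {x. 1 / real (Suc n) \<le> infdist x S})"
proof (intro incseq_SucI subsetI CollectI)
  fix n x assume "x \<in> {x. 1 / real (Suc n) \<le> infdist x S}"
  moreover have "1 / real (Suc (Suc n)) \<le> 1 / real (Suc n)"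
    by (intro divide_left_mono) auto
  ultimately show "1 / real (Suc (Suc n)) \<le> infdist x S"
    by simp
qed

text \<open>The sets that can be approximated from inside by closed sets together with their
  complements form a sigma-algebra containing the open sets. Carrying \<open>A\<close> and
  \<open>- A\<close> through the induction makes the complement step trivial. Neither separability
  nor completeness enters.\<close>

lemma closed_inner_regular:
  fixes M :: "'a::metric_space measure"
  assumes "finite_measure M" and sets: "sets M = sets borel" and A: "A \<in> sets borel" and "0 < e"
  obtains F where "closed F" "F \<subseteq> A" "measure M (A - F) \<le> e"
proof -
  interpret finite_measure M by fact
  define R where "R A \<longleftrightarrow> (\<forall>e>0. \<exists>F. closed F \<and> F \<subseteq> A \<and> measure M (A - F) \<le> e)" for A
  have closed_R: "R F" if "closed F" for F
    unfolding R_def using that by (intro allI impI exI[of _ F]) simp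
  have "A \<in> sigma_sets UNIV {S :: 'a set. open S}"
    using A by (simp add: sets_borel borel_def)
  then have "R A \<and> R (- A)"
  proof induction
    case (Basic U)
    then have U: "open U"
      by simp
    have "R U"
    proof (cases "- U = {}")
      case True
      then have "closed U"
        by (metis boolean_algebra.compl_zero closed_UNIV double_complement)
      then show ?thesis
        by (rule closed_R)
    next
      case False
      define F where "F n = {x. 1 / real (Suc n) \<le> infdist x (- U)}" for n
      have F: "closed (F n)" for n
        unfolding F_def by (rule closed_infdist_ge)
      have UN: "(\<Union>n. F n) = U"
        unfolding F_def using U False by (subst infdist_ge_UN) (auto simp: closed_Compl)
      have "incseq F"
        unfolding F_def by (rule incseq_infdist_ge)
      show ?thesis
        unfolding R_def
      proof (intro allI impI)
        fix e :: real assume "0 < e"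
        then obtain n where "measure M ((\<Union>n. F n) - F n) \<le> e"
          using F \<open>incseq F\<close> incseq_Union_approx[of F e] by (auto simp: sets)
        then show "\<exists>F. closed F \<and> F \<subseteq> U \<and> measure M (U - F) \<le> e"
          using F UN by blast
      qed
    qed
    then show ?case
      using U by (auto intro: closed_R)
  next
    case Empty
    then show ?case
      by (auto intro: closed_R)
  next
    case (Compl A)
    then show ?case
      by (simp add: Compl_eq_Diff_UNIV[symmetric])
  next
    case (Union A)
    have A[measurable]: "A i \<in> sets M" for i
      using Union.hyps[of i] by (simp add: sets borel_def)
    have "R (\<Union>i. A i)"
      unfolding R_def
    proof (intro allI impI)
      fix e :: real assume e: "0 < e"
      \<comment> \<open>A countable union of closed sets need not be closed, so the union is cut off
        at a finite stage; half of \<open>e\<close> pays for the tail and half for the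
        approximations.\<close>
      have "\<exists>F. closed F \<and> F \<subseteq> A i \<and> measure M (A i - F) \<le> (e / 2) * (1 / 2) ^ Suc i" for i
      proof -
        have "0 < (e / 2) * (1 / 2) ^ Suc i"
          using e by simp
        then show ?thesis
          using Union.IH[of i] unfolding R_def by blast
      qed
      then obtain F where F: "\<And>i. closed (F i)" "\<And>i. F i \<subseteq> A i"
        "\<And>i. measure M (A i - F i) \<le> (e / 2) * (1 / 2) ^ Suc i"
        by metis
      have [measurable]: "F i \<in> sets M" for i
        using F by (simp add: sets)
      have UN: "(\<Union>n. \<Union>i<n. A i) = (\<Union>i. A i)"
        by auto
      have "incseq (\<lambda>n. \<Union>i<n. A i)"
        by (intro incseq_SucI UN_mono) auto
      then obtain n where n: "measure M ((\<Union>n. \<Union>i<n. A i) - (\<Union>i<n. A i)) \<le> e / 2"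
        using incseq_Union_approx[of "\<lambda>n. \<Union>i<n. A i" "e / 2"] e by auto
      have "measure M ((\<Union>i. A i) - (\<Union>i<n. F i)) \<le>
          measure M (((\<Union>i. A i) - (\<Union>i<n. A i)) \<union> (\<Union>i. A i - F i))"
        by (intro finite_measure_mono) auto
      also have "\<dots> \<le> measure M ((\<Union>i. A i) - (\<Union>i<n. A i)) + measure M (\<Union>i. A i - F i)"
        by (intro measure_Un_le) auto
      also have "measure M (\<Union>i. A i - F i) \<le> e / 2"
        by (intro measure_Union_le_geometric F) auto
      finally have "measure M ((\<Union>i. A i) - (\<Union>i<n. F i)) \<le> e"
        using n by (simp add: UN)
      moreover have "closed (\<Union>i<n. F i)" "(\<Union>i<n. F i) \<subseteq> (\<Union>i. A i)"
        using F by blast+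
      ultimately show "\<exists>F. closed F \<and> F \<subseteq> (\<Union>i. A i) \<and> measure M ((\<Union>i. A i) - F) \<le> e"
        by blast
    qed
    moreover have "R (- (\<Union>i. A i))"
      unfolding R_def
    proof (intro allI impI)
      fix e :: real assume e: "0 < e"
      \<comment> \<open>Intersections of closed sets are closed, so here all the \<open>F i\<close>
        are kept and the whole of \<open>e\<close> goes to the approximations.\<close>
      have "\<exists>F. closed F \<and> F \<subseteq> - A i \<and> measure M (- A i - F) \<le> e * (1 / 2) ^ Suc i" for i
      proof -
        have "0 < e * (1 / 2) ^ Suc i"
          using e by simp
        then show ?thesis
          using Union.IH[of i] unfolding R_def by blast
      qed
      then obtain F where F: "\<And>i. closed (F i)" "\<And>i. F i \<subseteq> - A i"
        "\<And>i. measure M (- A i - F i) \<le> e * (1 / 2) ^ Suc i"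
        by metis
      have [measurable]: "F i \<in> sets M" for i
        using F by (simp add: sets)
      have cA: "- A i \<in> sets M" for i
        using sets.compl_sets[OF A[of i]] by (simp add: sets_eq_imp_space_eq[OF sets] Compl_eq_Diff_UNIV)
      have "measure M (- (\<Union>i. A i) - (\<Inter>i. F i)) \<le> measure M (\<Union>i. - A i - F i)"
        using cA by (intro finite_measure_mono) auto
      also have "\<dots> \<le> e"
        using cA by (intro measure_Union_le_geometric F) auto
      finally have "measure M (- (\<Union>i. A i) - (\<Inter>i. F i)) \<le> e" .
      moreover have "closed (\<Inter>i. F i)" "(\<Inter>i. F i) \<subseteq> - (\<Union>i. A i)"
        using F by blast+
      ultimately show "\<exists>F. closed F \<and> F \<subseteq> - (\<Union>i. A i) \<and> measure M (- (\<Union>i. A i) - F) \<le> e"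
        by blast
    qed
    ultimately show ?case ..
  qed
  with \<open>0 < e\<close> show thesis
    using that unfolding R_def by blast
qed

text \<open>Ulam's theorem, carried out in a complete metric \<open>d\<close> that induces the
  topology, since \<open>dist\<close> itself need not be complete. For each n, finitely many closed
  \<open>d\<close>-balls of radius 1 / (n + 1) carry all but e / 2^(n + 1) of the mass; the
  intersection of these finite unions is closed and totally bounded.\<close>

lemma polish_topology_tight:
  fixes M :: "'a::metric_space measure"
  assumes "polish_topology (euclidean :: 'a topology)"
    and "finite_measure M" and sets: "sets M = sets borel" and "0 < e"
  obtains C where "compact C" "measure M (- C) \<le> e"
proof -
  interpret finite_measure M by fact
  obtain X d where "Metric_space X d" "Metric_space.mcomplete X d"
    and top: "(euclidean :: 'a topology) = Metric_space.mtopology X d"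
    using assms(1) by (auto simp: polish_topology_def completely_metrizable_space_def)
  interpret d: Metric_space X d by fact
  have "X = UNIV"
    using arg_cong[OF top, of topspace] by simp
  then have X: "x \<in> X" for x
    by simp
  obtain D :: "'a set" where D: "countable D" "euclidean closure_of D = UNIV"
    using assms(1) by (auto simp: polish_topology_def separable_space_def)
  have "D \<noteq> {}"
    using D(2) by auto
  define c where "c = from_nat_into D"
  have cover: "(\<Union>i. d.mcball (c i) r) = UNIV" if r: "0 < r" for r
  proof (intro UNIV_eq_I[symmetric] set_eqI iffI UNIV_I)
    fix x
    have "x \<in> d.mtopology closure_of D"
      using D by (simp add: top[symmetric])
    then obtain y where "y \<in> D" "y \<in> d.mcball x r"
      using r unfolding d.metric_closure_of_alt by blast
    then obtain i where "c i \<in> d.mcball x r"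
      unfolding c_def by (metis D(1) from_nat_into_surj)
    then have "x \<in> d.mcball (c i) r"
      by (simp add: d.commute X)
    then show "x \<in> (\<Union>i. d.mcball (c i) r)"
      by blast
  qed
  have cl: "closed (d.mcball x r)" for x r
    using d.closedin_mcball by (simp add: closed_closedin top)
  have "\<exists>k. measure M (- (\<Union>i<k. d.mcball (c i) (1 / real (Suc n)))) \<le> e * (1 / 2) ^ Suc n" for n
  proof -
    let ?U = "\<lambda>k. \<Union>i<k. d.mcball (c i) (1 / real (Suc n))"
    have "(\<Union>k. ?U k) = (\<Union>i. d.mcball (c i) (1 / real (Suc n)))"
      by auto
    then have UN: "(\<Union>k. ?U k) = UNIV"
      by (simp add: cover)
    obtain k where "measure M ((\<Union>k. ?U k) - ?U k) \<le> e * (1 / 2) ^ Suc n"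
    proof (rule incseq_Union_approx[of ?U "e * (1 / 2) ^ Suc n"])
      show "?U k \<in> sets M" for k
        unfolding sets by (intro borel_closed closed_UN finite_lessThan ballI cl)
      show "incseq ?U"
        by (intro incseq_SucI UN_mono) auto
    qed (use \<open>0 < e\<close> in auto)
    then show ?thesis
      unfolding UN by (auto simp: Compl_eq_Diff_UNIV)
  qed
  then obtain k where k: "\<And>n. measure M (- (\<Union>i<k n. d.mcball (c i) (1 / real (Suc n)))) \<le> e * (1 / 2) ^ Suc n"
    by metis
  define V where "V n = (\<Union>i<k n. d.mcball (c i) (1 / real (Suc n)))" for n
  have V: "closed (V n)" for n
    unfolding V_def by (intro closed_UN finite_lessThan ballI cl)
  have V_le: "measure M (- V n) \<le> e * (1 / 2) ^ Suc n" for n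
    unfolding V_def by (rule k)
  define C where "C = (\<Inter>n. V n)"
  have "closed C"
    unfolding C_def using V by blast
  have tb: "d.mtotally_bounded C"
    unfolding d.mtotally_bounded_def
  proof (intro allI impI)
    fix r :: real assume "0 < r"
    then obtain n where n: "inverse (real (Suc n)) < r / 2"
      using reals_Archimedean[of "r / 2"] by auto
    \<comment> \<open>Total boundedness asks for net points inside \<open>C\<close>, so balls
      missing \<open>C\<close> are discarded and a point of \<open>C\<close> is picked in each of
      the others. Two points of one ball are at distance at most 2 / (n + 1) < r.\<close>
    define I where "I = {i. i < k n \<and> C \<inter> d.mcball (c i) (1 / real (Suc n)) \<noteq> {}}"
    have "\<forall>i\<in>I. \<exists>p. p \<in> C \<inter> d.mcball (c i) (1 / real (Suc n))"
      by (auto simp: I_def)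
    then obtain p where p: "\<And>i. i \<in> I \<Longrightarrow> p i \<in> C \<inter> d.mcball (c i) (1 / real (Suc n))"
      by metis
    show "\<exists>P. finite P \<and> P \<subseteq> C \<and> C \<subseteq> (\<Union>x\<in>P. d.mball x r)"
    proof (intro exI[of _ "p ` I"] conjI)
      show "finite (p ` I)"
        by (simp add: I_def)
      show "p ` I \<subseteq> C"
        using p by auto
      show "C \<subseteq> (\<Union>x\<in>p ` I. d.mball x r)"
      proof
        fix x assume x: "x \<in> C"
        then have "x \<in> V n"
          by (auto simp: C_def)
        then obtain i where i: "i < k n" "x \<in> d.mcball (c i) (1 / real (Suc n))"
          by (auto simp: V_def)
        then have "i \<in> I"
          using x by (auto simp: I_def)
        with p[of i] have "d (c i) (p i) \<le> 1 / real (Suc n)"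
          by simp
        moreover have "d (c i) x \<le> 1 / real (Suc n)"
          using i by simp
        ultimately have "d (p i) x < r"
          using n d.triangle''[of "p i" "c i" x] by (simp add: X inverse_eq_divide d.commute[of "p i"])
        then show "x \<in> (\<Union>x\<in>p ` I. d.mball x r)"
          using \<open>i \<in> I\<close> by (auto simp: X)
      qed
    qed
  qed
  \<comment> \<open>Completeness of \<open>d\<close> turns total boundedness into compactness of the
    closure, and \<open>C\<close> is closed.\<close>
  have "compactin d.mtopology (d.mtopology closure_of C)"
    using tb d.mtotally_bounded_eq_compact_closure_of[OF \<open>d.mcomplete\<close>] by blast
  then have "compact (euclidean closure_of C)"
    by (simp add: top[symmetric])
  moreover have "euclidean closure_of C = C"
    using \<open>closed C\<close> by (metis closed_closedin closure_of_closedin)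
  ultimately have "compact C"
    by simp
  moreover have "measure M (- C) \<le> e"
  proof -
    have "- C = (\<Union>n. - V n)"
      by (auto simp: C_def)
    moreover have "- V n \<in> sets M" for n
      using V[of n] by (simp add: sets)
    ultimately show ?thesis
      using V_le by (simp add: measure_Union_le_geometric)
  qed
  ultimately show thesis
    by (rule that)
qed

text \<open>Lower semicontinuity makes the sets where \<open>f\<close> exceeds 1 / (n + 1) open.
  They cover \<open>C\<close>, and the indices of a finite subcover have an upper bound, which
  yields \<open>e\<close>.\<close>

lemma lower_semicontinuous_pos_compact:
  fixes f :: "'a::topological_space \<Rightarrow> real"
  assumes lsc: "lower_semicontinuous f" and C: "compact C" and pos: "\<And>z. z \<in> C \<Longrightarrow> 0 < f z"
  obtains e where "0 < e" "\<And>z. z \<in> C \<Longrightarrow> e < f z"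
proof -
  have op: "open {z. c < f z}" for c
  proof (subst open_subopen, intro ballI)
    fix z assume "z \<in> {z. c < f z}"
    then have "\<forall>\<^sub>F w in nhds z. c < f w"
      using lsc by (simp add: lower_semicontinuous_def)
    then show "\<exists>T. open T \<and> z \<in> T \<and> T \<subseteq> {z. c < f z}"
      unfolding eventually_nhds by blast
  qed
  have "C \<subseteq> (\<Union>n. {z. 1 / real (Suc n) < f z})"
  proof
    fix z assume "z \<in> C"
    then obtain n where "inverse (real (Suc n)) < f z"
      using pos reals_Archimedean by blast
    then show "z \<in> (\<Union>n. {z. 1 / real (Suc n) < f z})"
      by (auto simp: inverse_eq_divide intro!: exI[of _ n])
  qed
  then obtain N :: "nat set" where "N \<subseteq> UNIV"
    and N: "finite N" "C \<subseteq> (\<Union>n\<in>N. {z. 1 / real (Suc n) < f z})"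
    by (rule compactE_image[OF C op])
  obtain m where m: "\<forall>n\<in>N. n \<le> m"
    using N(1) unfolding finite_nat_set_iff_bounded_le by (rule exE)
  show thesis
  proof (rule that[of "1 / real (Suc m)"])
    fix z assume "z \<in> C"
    then obtain n where n: "n \<in> N" "1 / real (Suc n) < f z"
      using N(2) by auto
    have "1 / real (Suc m) \<le> 1 / real (Suc n)"
      using m n(1) by (intro divide_left_mono) auto
    with n show "1 / real (Suc m) < f z"
      by simp
  qed simp
qed

text \<open>Inner regularity gives disjoint closed sets carrying almost all mass. For
  \<open>\<rho> = dist\<close>, points outside a closed set have positive distance from it, and a
  further small loss of \<open>\<nu>\<close>-mass makes this distance uniform. Otherwise tightness
  cuts both sets down to compact ones, on whose product \<open>\<rho>\<close> is bounded away from
  0.\<close>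

lemma separate_singular_measures:
  fixes \<mu> \<nu> :: "'a::metric_space measure" and \<rho> :: "'a \<Rightarrow> 'a \<Rightarrow> real"
  assumes \<rho>: "\<rho> = dist \<or> (polish_topology (euclidean :: 'a topology) \<and>
      lower_semicontinuous (\<lambda>(x, y). \<rho> x y) \<and> positive_definite \<rho>)"
    and nonneg: "\<And>x y. 0 \<le> \<rho> x y"
    and fin: "finite_measure \<mu>" "finite_measure \<nu>" and sets: "sets \<mu> = sets borel" "sets \<nu> = sets borel"
    and A: "A \<in> sets borel" and null: "emeasure \<mu> (- A) = 0" "emeasure \<nu> A = 0" and "0 < \<delta>"
  obtains F G e where "F \<in> sets borel" "G \<in> sets borel" "0 < e"
    "measure \<mu> (- F) \<le> \<delta>" "measure \<nu> (- G) \<le> \<delta>" "\<And>x y. x \<in> F \<Longrightarrow> y \<in> G \<Longrightarrow> e < \<rho> x y"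
proof -
  interpret \<mu>: finite_measure \<mu> by fact
  interpret \<nu>: finite_measure \<nu> by fact
  have cA: "- A \<in> sets borel"
    using A by auto
  have half: "0 < \<delta> / 2"
    using \<open>0 < \<delta>\<close> by simp
  have null': "measure \<mu> (- A) = 0" "measure \<nu> A = 0"
    using null by (simp_all add: measure_def)
  obtain F where F: "closed F" "F \<subseteq> A" "measure \<mu> (A - F) \<le> \<delta> / 2"
    by (rule closed_inner_regular[OF fin(1) sets(1) A half])
  obtain G where G: "closed G" "G \<subseteq> - A" "measure \<nu> (- A - G) \<le> \<delta> / 2"
    by (rule closed_inner_regular[OF fin(2) sets(2) cA half])
  have F_le: "measure \<mu> (- F) \<le> \<delta> / 2"
  proof -
    have "measure \<mu> (- F) \<le> measure \<mu> ((A - F) \<union> - A)"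
      using A cA F(1) by (intro \<mu>.finite_measure_mono) (auto simp: sets)
    also have "\<dots> \<le> measure \<mu> (A - F) + measure \<mu> (- A)"
      using A cA F(1) by (intro measure_Un_le) (auto simp: sets)
    finally show ?thesis
      using F(3) null' by simp
  qed
  have G_le: "measure \<nu> (- G) \<le> \<delta> / 2"
  proof -
    have "measure \<nu> (- G) \<le> measure \<nu> ((- A - G) \<union> A)"
      using A cA G(1) by (intro \<nu>.finite_measure_mono) (auto simp: sets)
    also have "\<dots> \<le> measure \<nu> (- A - G) + measure \<nu> A"
      using A cA G(1) by (intro measure_Un_le) (auto simp: sets)
    finally show ?thesis
      using G(3) null' by simp
  qed
  from \<rho> show thesis
  proof
    assume \<rho>: "\<rho> = dist"
    show thesis
    proof (cases "F = {}")
      \<comment> \<open>With \<open>F\<close> empty there is no pair to separate, so the value 1 is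
        arbitrary; the construction by \<open>infdist\<close> would break down because the distance
        to the empty set is 0.\<close>
      case True
      show thesis
        by (rule that[of F G 1]) (use F(1) G(1) F_le G_le \<open>0 < \<delta>\<close> True in auto)
    next
      case False
      define H where "H n = G \<inter> {x. 1 / real (Suc n) \<le> infdist x F}" for n
      have H: "closed (H n)" for n
        unfolding H_def using G(1) closed_infdist_ge by (rule closed_Int)
      have "(\<Union>n. H n) = G \<inter> - F"
        unfolding H_def using infdist_ge_UN[OF F(1) False] by auto
      then have UN: "(\<Union>n. H n) = G"
        using F(2) G(2) by auto
      have inc_H: "incseq H"
        using incseq_infdist_ge[of F] unfolding H_def incseq_def by blast
      have sets_H: "H n \<in> sets \<nu>" for n
        using H by (simp add: sets)
      obtain n where n: "measure \<nu> ((\<Union>n. H n) - H n) \<le> \<delta> / 2"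
        by (rule \<nu>.incseq_Union_approx[OF sets_H inc_H half])
      have "measure \<nu> (- H n) \<le> measure \<nu> (- G \<union> (G - H n))"
        using H G(1) by (intro \<nu>.finite_measure_mono) (auto simp: sets)
      also have "\<dots> \<le> measure \<nu> (- G) + measure \<nu> (G - H n)"
        using H G(1) by (intro measure_Un_le) (auto simp: sets)
      finally have H_le: "measure \<nu> (- H n) \<le> \<delta>"
        using n G_le by (simp add: UN)
      show thesis
      \<comment> \<open>The distance is at least 1 / (n + 1); half of this gives the strict
        inequality.\<close>
      proof (rule that[of F "H n" "1 / (2 * real (Suc n))"])
        fix x y assume "x \<in> F" "y \<in> H n"
        then have "1 / real (Suc n) \<le> dist y x"
          using infdist_le[of x F y] by (auto simp: H_def)
        moreover have "1 / (2 * real (Suc n)) < 1 / real (Suc n)"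
          by (simp add: field_simps)
        ultimately show "1 / (2 * real (Suc n)) < \<rho> x y"
          by (simp add: \<rho> dist_commute)
      qed (use F(1) H F_le H_le \<open>0 < \<delta>\<close> in auto)
    qed
  next
    assume *: "polish_topology (euclidean :: 'a topology) \<and>
      lower_semicontinuous (\<lambda>(x, y). \<rho> x y) \<and> positive_definite \<rho>"
    then have polish: "polish_topology (euclidean :: 'a topology)"
      and lsc: "lower_semicontinuous (\<lambda>(x, y). \<rho> x y)" and pd: "positive_definite \<rho>"
      by simp_all
    obtain C where C: "compact C" "measure \<mu> (- C) \<le> \<delta> / 2"
      by (rule polish_topology_tight[OF polish fin(1) sets(1) half])
    obtain D where D: "compact D" "measure \<nu> (- D) \<le> \<delta> / 2"
      by (rule polish_topology_tight[OF polish fin(2) sets(2) half])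
    have compact: "compact ((F \<inter> C) \<times> (G \<inter> D))"
      using F(1) G(1) C(1) D(1) by (intro compact_Times closed_Int_compact)
    have pos: "0 < \<rho> x y" if "x \<in> F" "y \<in> G" for x y
    proof -
      have "x \<noteq> y"
        using that F(2) G(2) by auto
      then show ?thesis
        using pd nonneg[of x y] by (auto simp: positive_definite_def less_le)
    qed
    obtain e where e: "0 < e" "\<And>z. z \<in> (F \<inter> C) \<times> (G \<inter> D) \<Longrightarrow> e < (\<lambda>(x, y). \<rho> x y) z"
      by (rule lower_semicontinuous_pos_compact[OF lsc compact]) (use pos in auto)
    have cl: "closed C" "closed D"
      using C(1) D(1) by (auto intro: compact_imp_closed)
    show thesis
    proof (rule that[of "F \<inter> C" "G \<inter> D" e])
      have "measure \<mu> (- (F \<inter> C)) \<le> measure \<mu> (- F) + measure \<mu> (- C)"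
        unfolding Compl_Int using F(1) cl by (intro measure_Un_le) (auto simp: sets)
      then show "measure \<mu> (- (F \<inter> C)) \<le> \<delta>"
        using F_le C(2) by simp
      have "measure \<nu> (- (G \<inter> D)) \<le> measure \<nu> (- G) + measure \<nu> (- D)"
        unfolding Compl_Int using G(1) cl by (intro measure_Un_le) (auto simp: sets)
      then show "measure \<nu> (- (G \<inter> D)) \<le> \<delta>"
        using G_le D(2) by simp
      show "e < \<rho> x y" if "x \<in> F \<inter> C" "y \<in> G \<inter> D" for x y
        using e(2)[of "(x, y)"] that by simp
    qed (use F(1) G(1) cl e(1) in auto)
  qed
qed

section \<open>Generalized couplings\<close>

text \<open>Dividing the mass 4^-n by the frequency 2^-n bounds the mass of the exceptional set by
  2^-n, which is summable, so Borel-Cantelli applies.\<close>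

lemma AE_eventually_no_excess:
  assumes K: "markov_kernel S K" and inv: "invariant_prob S K \<mu>"
    and D: "\<And>n. D n \<in> sets S" and le: "\<And>n. measure \<mu> (D n) \<le> (1 / 4) ^ n"
  shows "AE x in \<mu>. \<forall>\<^sub>F n in sequentially. emeasure (chain_law S K x) (excess S ((1 / 2) ^ n) (D n)) = 0"
proof -
  interpret prob_space \<mu>
    by (rule prob_space_invariant[OF K inv])
  define Z where "Z n = {x \<in> space S. emeasure (chain_law S K x) (excess S ((1 / 2) ^ n) (D n)) \<noteq> 0}" for n
  have Z: "Z n \<in> sets \<mu>" for n
    unfolding Z_def sets_invariant[OF K inv]
    using emeasure_chain_law_measurable[OF K sets_excess[OF D[of n], of "(1 / 2) ^ n"]] by measurable
  have Z_le: "measure \<mu> (Z n) \<le> (1 / 2) ^ n" for n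
  proof -
    have "(1 / 2) ^ n * measure \<mu> (Z n) \<le> (1 / 4) ^ n"
      using measure_excess_le[OF K inv D[of n], of "(1 / 2) ^ n"] le[of n] unfolding Z_def by simp
    also have "\<dots> = (1 / 2) ^ n * ((1 / 2) ^ n :: real)"
      by (simp add: power_mult_distrib[symmetric])
    finally show ?thesis
      by (simp add: mult_le_cancel_left_pos)
  qed
  have "AE x in \<mu>. \<forall>\<^sub>F n in sequentially. x \<in> space \<mu> - Z n"
  proof (rule borel_cantelli_AE1)
    show "summable (\<lambda>n. measure \<mu> (Z n))"
      by (rule summable_comparison_test'[of "\<lambda>n. (1 / 2) ^ n" 0]) (simp_all add: Z_le summable_geometric)
  qed (simp_all add: Z less_top[symmetric])
  with AE_space show ?thesis
    by eventually_elim (auto simp: Z_def space_invariant[OF K inv] elim: eventually_mono)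
qed

text \<open>Division by n removes the additive constant \<open>C\<close> in the limit. The
  comparison is made for positive n only, as 1 / 0 is 0 by convention.\<close>

lemma limsup_average_less:
  fixes f :: "nat \<Rightarrow> real"
  assumes "\<And>n. f n \<le> C + c * real n" and "c < \<alpha>"
  shows "limsup (\<lambda>n. ereal (1 / real n * f n)) < ereal \<alpha>"
proof -
  have "(\<lambda>n. C * inverse (real n) + c) \<longlonglongrightarrow> C * 0 + c"
    by (intro tendsto_intros lim_inverse_n)
  then have "(\<lambda>n. ereal (C * inverse (real n) + c)) \<longlonglongrightarrow> ereal c"
    by simp
  then have "limsup (\<lambda>n. ereal (C * inverse (real n) + c)) = ereal c"
    by (intro lim_imp_Limsup) simp_all
  moreover have "\<forall>\<^sub>F n in sequentially. ereal (1 / real n * f n) \<le> ereal (C * inverse (real n) + c)"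
    using eventually_gt_at_top[of 0]
  proof eventually_elim
    fix n :: nat assume "0 < n"
    then show "ereal (1 / real n * f n) \<le> ereal (C * inverse (real n) + c)"
      using assms(1)[of n] by (simp add: field_simps)
  qed
  ultimately have "limsup (\<lambda>n. ereal (1 / real n * f n)) \<le> ereal c"
    by (metis Limsup_mono)
  also have "\<dots> < ereal \<alpha>"
    using \<open>c < \<alpha>\<close> by simp
  finally show ?thesis .
qed

lemma absolutely_continuous_vimage_null:
  assumes ac: "absolutely_continuous \<mu> (distr \<xi> \<mu> f)" and f: "f \<in> \<xi> \<rightarrow>\<^sub>M \<mu>" and N: "N \<in> null_sets \<mu>"
  shows "f -` N \<inter> space \<xi> \<in> null_sets \<xi>"
proof -
  have "N \<in> null_sets (distr \<xi> \<mu> f)"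
    using ac N by (auto simp: absolutely_continuous_def)
  then show ?thesis
    using null_sets_distr_iff[OF f] by simp
qed

text \<open>Whenever the paths are \<epsilon>-close at some time, the first is outside
  \<open>F\<close> or the second outside \<open>G\<close>. Absolute continuity pulls the two null
  excess events back to null events of the coupling, and off these each kind of visit has upper
  frequency at most \<open>c\<close>, so closeness has upper frequency at most
  \<open>2 * c\<close>.\<close>

lemma generalized_coupling_not_close:
  fixes P :: "'a::topological_space \<Rightarrow> 'a measure" and \<rho> :: "'a \<Rightarrow> 'a \<Rightarrow> real"
  assumes P: "markov_kernel borel P"
    and \<Xi>: "\<Xi> \<in> generalized_couplings (chain_law borel P x) (chain_law borel P y)"
    and sets: "F \<in> sets borel" "G \<in> sets borel"
    and nx: "emeasure (chain_law borel P x) (excess borel c (- F)) = 0"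
    and ny: "emeasure (chain_law borel P y) (excess borel c (- G)) = 0"
    and sep: "\<And>x y. x \<in> F \<Longrightarrow> y \<in> G \<Longrightarrow> \<epsilon> < \<rho> x y" and "2 * c < \<alpha>"
  shows "outer_measure_of \<Xi> {(\<xi>, \<eta>). limsup (\<lambda>n. ereal (1 / real n *
      (\<Sum>i<n. indicator {0..\<epsilon>} (\<rho> (\<xi> i) (\<eta> i))))) \<ge> ereal \<alpha>} = 0" (is "outer_measure_of \<Xi> ?T = 0")
proof -
  let ?Lx = "chain_law borel P x" and ?Ly = "chain_law borel P y"
  define B where "B D = excess borel c D" for D :: "'a set"
  have sets_\<Xi>: "sets \<Xi> = sets (?Lx \<Otimes>\<^sub>M ?Ly)"
    and ac: "absolutely_continuous ?Lx (distr \<Xi> ?Lx fst)" "absolutely_continuous ?Ly (distr \<Xi> ?Ly snd)"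
    using \<Xi> by (auto simp: generalized_couplings_def)
  have sL: "sets ?Lx = sets (path_space borel)" "sets ?Ly = sets (path_space borel)"
    using P by (simp_all add: sets_chain_law)
  have "space \<Xi> = space ?Lx \<times> space ?Ly"
    using sets_eq_imp_space_eq[OF sets_\<Xi>] by (simp add: space_pair_measure)
  then have sp: "space \<Xi> = UNIV"
    using sets_eq_imp_space_eq[OF sL(1)] sets_eq_imp_space_eq[OF sL(2)] by (simp add: space_PiM PiE_def)
  have m: "fst \<in> \<Xi> \<rightarrow>\<^sub>M ?Lx" "snd \<in> \<Xi> \<rightarrow>\<^sub>M ?Ly"
    by (simp_all add: measurable_cong_sets[OF sets_\<Xi> refl])
  have "B (- F) \<in> null_sets ?Lx" "B (- G) \<in> null_sets ?Ly"
    using nx ny sets_excess[of "- F" borel c] sets_excess[of "- G" borel c] sets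
    by (auto simp: null_sets_def B_def sL)
  then have null: "fst -` B (- F) \<union> snd -` B (- G) \<in> null_sets \<Xi>"
    using absolutely_continuous_vimage_null[OF ac(1) m(1)] absolutely_continuous_vimage_null[OF ac(2) m(2)]
    by (auto simp: sp)
  \<comment> \<open>The closeness event need not be measurable; a measurable null set containing it
    settles its outer measure.\<close>
  have "?T \<subseteq> fst -` B (- F) \<union> snd -` B (- G)"
  proof (rule subsetI, rule ccontr)
    fix p assume p: "p \<in> ?T" "p \<notin> fst -` B (- F) \<union> snd -` B (- G)"
    obtain \<xi> \<eta> where [simp]: "p = (\<xi>, \<eta>)"
      by (cases p)
    have "\<xi> \<notin> B (- F)" "\<eta> \<notin> B (- G)"
      using p(2) by simp_all
    \<comment> \<open>Off \<open>excess\<close>, the number of visits has a bound affine in n with a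
      constant that depends on the path only.\<close>
    then obtain C1 C2 :: nat where
      C: "\<And>n. (\<Sum>i<n. indicator (- F) (\<xi> i)) \<le> real C1 + c * real n"
        "\<And>n. (\<Sum>i<n. indicator (- G) (\<eta> i)) \<le> real C2 + c * real n"
      by (auto simp: B_def excess_def space_PiM not_less)
    have "(\<Sum>i<n. indicator {0..\<epsilon>} (\<rho> (\<xi> i) (\<eta> i))) \<le> real (C1 + C2) + 2 * c * real n" for n
    proof -
      have "(\<Sum>i<n. indicator {0..\<epsilon>} (\<rho> (\<xi> i) (\<eta> i))) \<le>
          (\<Sum>i<n. indicator (- F) (\<xi> i) + indicator (- G) (\<eta> i) :: real)"
      proof (rule sum_mono)
        show "indicator {0..\<epsilon>} (\<rho> (\<xi> i) (\<eta> i)) \<le>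
            (indicator (- F) (\<xi> i) + indicator (- G) (\<eta> i) :: real)" for i
          using sep[of "\<xi> i" "\<eta> i"]
          by (cases "\<xi> i \<in> F"; cases "\<eta> i \<in> G") (simp_all add: indicator_def)
      qed
      also have "\<dots> \<le> real (C1 + C2) + 2 * c * real n"
        using C[of n] by (simp add: sum.distrib)
      finally show ?thesis .
    qed
    then have "limsup (\<lambda>n. ereal (1 / real n * (\<Sum>i<n. indicator {0..\<epsilon>} (\<rho> (\<xi> i) (\<eta> i))))) < ereal \<alpha>"
      using \<open>2 * c < \<alpha>\<close> by (rule limsup_average_less)
    with p(1) show False
      by simp
  qed
  then have "outer_measure_of \<Xi> ?T \<le> outer_measure_of \<Xi> (fst -` B (- F) \<union> snd -` B (- G))"
    by (rule outer_measure_of_mono)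
  also have "\<dots> = 0"
    using null by (simp add: null_setsD1 null_setsD2)
  finally show ?thesis
    by simp
qed

theorem corollary3p2:
  fixes P :: "'a::metric_space \<Rightarrow> 'a measure"
    and \<rho> :: "'a \<Rightarrow> 'a \<Rightarrow> real"
    and M :: "'a set"
  assumes "markov_kernel borel P"
    and "\<forall>x y. 0 \<le> \<rho> x y"
    and "\<rho> = dist \<or>
         (polish_topology (euclidean :: 'a topology) \<and>
          lower_semicontinuous (\<lambda>(x, y). \<rho> x y) \<and> positive_definite \<rho>)"
    and "M \<in> sets borel"
    and "\<forall>\<mu>. invariant_prob borel P \<mu> \<longrightarrow> emeasure \<mu> M > 0"
    and "\<forall>x\<in>M. \<forall>y\<in>M. \<exists>\<alpha>::real. \<alpha> > 0 \<and> (\<forall>\<epsilon>::real. \<epsilon> > 0 \<longrightarrow>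
           (\<exists>\<Xi> \<in> generalized_couplings (chain_law borel P x) (chain_law borel P y).
              outer_measure_of \<Xi>
                {(\<xi>, \<eta>). limsup (\<lambda>n. ereal (1 / real n *
                    (\<Sum>i<n. indicator {0..\<epsilon>} (\<rho> (\<xi> i) (\<eta> i))))) \<ge> ereal \<alpha>} > 0))"
  shows "\<exists>\<^sub>\<le>\<^sub>1 \<mu>. invariant_prob borel P \<mu>"
proof (rule Uniq_I, rule ccontr)
  fix \<mu>1 \<mu>2 assume inv12: "invariant_prob borel P \<mu>1" "invariant_prob borel P \<mu>2" and "\<mu>1 \<noteq> \<mu>2"
  note P = assms(1)
  obtain \<mu> \<nu> A where inv: "invariant_prob borel P \<mu>" "invariant_prob borel P \<nu>"
    and A: "A \<in> sets borel" "emeasure \<mu> (space borel - A) = 0" "emeasure \<nu> A = 0"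
    using mutually_singular_invariant[OF P inv12 \<open>\<mu>1 \<noteq> \<mu>2\<close>] .
  interpret \<mu>: prob_space \<mu>
    by (rule prob_space_invariant[OF P inv(1)])
  interpret \<nu>: prob_space \<nu>
    by (rule prob_space_invariant[OF P inv(2)])
  note sets = sets_invariant[OF P inv(1)] sets_invariant[OF P inv(2)]
  have nonneg: "0 \<le> \<rho> x y" for x y
    using assms(2) by blast
  have A0: "emeasure \<mu> (- A) = 0"
    using A(2) by (simp add: Compl_eq_Diff_UNIV)
  \<comment> \<open>All levels n are prepared at once: \<alpha> depends on \<open>x\<close> and
    \<open>y\<close>, which are chosen with regard to the whole sequence of sets, so the level is
    fixed only afterwards.\<close>
  have "\<exists>F G e. F \<in> sets borel \<and> G \<in> sets borel \<and> 0 < e \<and> measure \<mu> (- F) \<le> (1 / 4) ^ n \<and>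
      measure \<nu> (- G) \<le> (1 / 4) ^ n \<and> (\<forall>x\<in>F. \<forall>y\<in>G. e < \<rho> x y)" for n :: nat
    by (rule separate_singular_measures[OF assms(3) nonneg \<mu>.finite_measure_axioms \<nu>.finite_measure_axioms
          sets A(1) A0 A(3), of "(1 / 4) ^ n"]) (simp, blast)
  then obtain F G e where FG: "\<And>n. F n \<in> sets borel" "\<And>n. G n \<in> sets borel" and e: "\<And>n. 0 < e n"
    and small: "\<And>n. measure \<mu> (- F n) \<le> (1 / 4) ^ n" "\<And>n. measure \<nu> (- G n) \<le> (1 / 4) ^ n"
    and sep: "\<And>n x y. x \<in> F n \<Longrightarrow> y \<in> G n \<Longrightarrow> e n < \<rho> x y"
    by metis
  have cFG: "- F n \<in> sets borel" "- G n \<in> sets borel" for n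
    using FG[of n] by auto
  \<comment> \<open>As \<open>M\<close> has positive mass under every invariant probability measure,
    it cannot be contained in a null set of exceptional points.\<close>
  have in_M: "\<exists>x\<in>M. Q x" if "invariant_prob borel P \<kappa>" "AE x in \<kappa>. Q x" for \<kappa> Q
  proof (rule ccontr)
    assume "\<not> (\<exists>x\<in>M. Q x)"
    with that(2) have "AE x in \<kappa>. x \<notin> M"
      by (auto elim: eventually_mono)
    moreover have "M \<in> sets \<kappa>"
      using assms(4) sets_invariant[OF P that(1)] by simp
    ultimately have "emeasure \<kappa> M = 0"
      by (simp add: AE_iff_null_sets null_setsD1)
    with assms(5) that(1) show False
      by auto
  qed
  obtain x where x: "x \<in> M"
    "\<forall>\<^sub>F n in sequentially. emeasure (chain_law borel P x) (excess borel ((1 / 2) ^ n) (- F n)) = 0"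
    using in_M[OF inv(1) AE_eventually_no_excess[OF P inv(1) cFG(1) small(1)]] by blast
  obtain y where y: "y \<in> M"
    "\<forall>\<^sub>F n in sequentially. emeasure (chain_law borel P y) (excess borel ((1 / 2) ^ n) (- G n)) = 0"
    using in_M[OF inv(2) AE_eventually_no_excess[OF P inv(2) cFG(2) small(2)]] by blast
  obtain \<alpha> :: real where \<alpha>: "0 < \<alpha>" and coupling: "\<And>\<epsilon>. 0 < \<epsilon> \<Longrightarrow>
      \<exists>\<Xi> \<in> generalized_couplings (chain_law borel P x) (chain_law borel P y).
        outer_measure_of \<Xi> {(\<xi>, \<eta>). limsup (\<lambda>n. ereal (1 / real n *
          (\<Sum>i<n. indicator {0..\<epsilon>} (\<rho> (\<xi> i) (\<eta> i))))) \<ge> ereal \<alpha>} > 0"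
    using assms(6) x(1) y(1) by meson
  have "(\<lambda>n. (1 / 2 :: real) ^ n) \<longlonglongrightarrow> 0"
    by (rule LIMSEQ_power_zero) simp
  then have "\<forall>\<^sub>F n in sequentially. (1 / 2 :: real) ^ n < \<alpha> / 2"
    using \<alpha> by (intro order_tendstoD) auto
  \<comment> \<open>For large n neither chain has an excess and twice the frequency 2^-n is below
    \<alpha>, so for the coupling belonging to \<open>e n\<close> the closeness event has outer
    measure both zero and positive. What is eventually true along \<open>sequentially\<close> holds
    somewhere, so \<open>False\<close> follows.\<close>
  with x(2) y(2) have "\<forall>\<^sub>F n in sequentially. False"
  proof eventually_elim
    case (elim n)
    obtain \<Xi> where \<Xi>: "\<Xi> \<in> generalized_couplings (chain_law borel P x) (chain_law borel P y)"
      and pos: "outer_measure_of \<Xi> {(\<xi>, \<eta>). limsup (\<lambda>k. ereal (1 / real k *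
          (\<Sum>i<k. indicator {0..e n} (\<rho> (\<xi> i) (\<eta> i))))) \<ge> ereal \<alpha>} > 0"
      using coupling[OF e[of n]] by blast
    have "2 * (1 / 2) ^ n < \<alpha>"
      using elim(3) by simp
    with P \<Xi> FG elim(1,2) sep
    have "outer_measure_of \<Xi> {(\<xi>, \<eta>). limsup (\<lambda>k. ereal (1 / real k *
          (\<Sum>i<k. indicator {0..e n} (\<rho> (\<xi> i) (\<eta> i))))) \<ge> ereal \<alpha>} = 0"
      by (rule generalized_coupling_not_close)
    with pos show False
      by simp
  qed
  then show False
    by simp
qed

end
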